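(* Let $n\ge 2$, $s\in\mathbb R\setminus\{0\}$, $m=\lfloor n/2\rfloor$, and $\kappa=\sum_{i=1}^{m}\kappa_{2i-1,2i}\,\mathbf e_{2i-1}\wedge\mathbf e_{2i}\in so(n)$ with $\kappa_{2i-1,2i}\ge0$. Assume that the parameters $\kappa_{2i-1,2i}$, $i=1,\dots,m$, are pairwise distinct and, if $n$ is odd, all different from zero. Then the magnetic flow $$\dot\gamma=p,\qquad \dot p=s\kappa p+\mu\gamma,\qquad \mu=s\langle p,\kappa\gamma\rangle-\langle p,p\rangle$$ on $T^*S^{n-1}$ is Liouville integrable (with respect to the twisted symplectic form $\omega+\mathbf f$) by means of the linear integrals $$\Phi_{2i-1,2i}=\gamma_{2i-1}p_{2i}-\gamma_{2i}p_{2i-1}+\frac{s\,\kappa_{2i-1,2i}}{2}\big(\gamma_{2i-1}^2+\gamma_{2i}^2\big),\qquad i=1,\dots,m,$$ and the quadratic integrals $$F_i=\sum_{k\ne i}\frac{|\phi_{i,k}|^2}{a_i-a_k}+|z_i|^2,\qquad i,k\in\{1,\dots,\ell\},\ \ \ell=\lceil n/2\rceil,$$ where $a_i$, $z_i$ and $\phi_{i,k}$ are defined in the context. That is, all these functions are first integrals, they pairwise Poisson commute, and among them there are $n-1$ functions that are functionally independent on an open dense subset of $T^*S^{n-1}$.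
   Context: Phase space: $T^*S^{n-1}=\{(\gamma,p)\in\mathbb R^{2n}\mid\langle\gamma,\gamma\rangle=1,\ \langle p,\gamma\rangle=0\}$ with the symplectic form $\omega+\mathbf f$, where $\omega=\big(\sum_{i=1}^n dp_i\wedge d\gamma_i\big)|_{T^*S^{n-1}}$ and $\mathbf f=\big(s\sum_{i<j}\kappa_{ij}\,d\gamma_i\wedge d\gamma_j\big)|_{T^*S^{n-1}}$. The magnetic flow is the Hamiltonian flow of $H=\frac12\langle p,p\rangle$ with respect to $\omega+\mathbf f$, and Poisson brackets are those of $\omega+\mathbf f$. Here $\mathbf e_j$ is the standard basis of $\mathbb R^n$ and $x\wedge y=xy^T-yx^T$, so $\kappa$ has entries $\kappa_{2i-1,2i}=-\kappa_{2i,2i-1}$ and all other entries zero. Definition of the quantities in $F_i$: let $\ell=\lceil n/2\rceil$, so $n=2\ell$ or $n=2\ell-1$. If $n=2\ell-1$, put $\kappa_{2\ell-1,2\ell}=0$ and $\gamma_{2\ell}=p_{2\ell}=0$. For $i=1,\dots,\ell$ set $z_i=\gamma_{2i-1}+\sqrt{-1}\gamma_{2i}$, $w_i=p_{2i-1}+\sqrt{-1}p_{2i}$, $a_i=\frac{s^2}{16}\kappa_{2i-1,2i}^2$, and $$\phi_{i,k}=\tfrac12(w_i\bar z_k-z_i\bar w_k)+\sqrt{-1}\,\tfrac{s}{4}(\kappa_{2i-1,2i}+\kappa_{2k-1,2k})\,z_i\bar z_k .$$ (Under the hypotheses the $a_1,\dots,a_\ell$ are pairwise distinct.) These functions satisfy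 $F_1+\dots+F_\ell=1$. Liouville integrability of a Hamiltonian system on a $2N$-dimensional symplectic manifold means existence of $N$ first integrals in involution that are functionally independent on an open dense set; here $N=n-1$. *)

theory Defs
  imports "HOL-Analysis.Analysis"
begin

text \<open>
  Vectors of \<open>\<real>\<^sup>n\<close> are rendered as \<^typ>\<open>real^'n\<close>, \<open>n = CARD('n)\<close>. Coordinates are numbered
  \<open>1,\<dots>,n\<close> through a bijection \<open>e\<close> from \<open>{1..n}\<close> onto the index type, so that the coordinate
  \<open>\<gamma>\<^sub>j\<close> is \<open>\<gamma> $ e j\<close> and the standard basis vector number \<open>j\<close> is \<open>axis (e j) 1\<close>.
  A point of the phase space, and also a tangent vector, is a pair of vectors (the \<open>\<gamma>\<close>-part and the \<open>p\<close>-part).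
\<close>

type_synonym 'n phase = "(real^'n) \<times> (real^'n)"


section \<open>The cotangent bundle of the sphere with the twisted symplectic form\<close>

definition cotangent_sphere :: "'n::finite phase set" where
  "cotangent_sphere = {(\<gamma>, p). \<gamma> \<bullet> \<gamma> = 1 \<and> p \<bullet> \<gamma> = 0}"

text \<open>The tangent space is the kernel of the differentials of the two defining equations.\<close>

definition tangent_at :: "'n::finite phase \<Rightarrow> 'n phase set" where
  "tangent_at x = {(u, v). fst x \<bullet> u = 0 \<and> v \<bullet> fst x + snd x \<bullet> u = 0}"

definition wedge :: "real^'n \<Rightarrow> real^'n \<Rightarrow> real^'n^'n" where
  "wedge x y = (\<chi> i j. x $ i * y $ j - y $ i * x $ j)"

text \<open>The parameter \<open>\<kappa>\<^bsub>2i-1,2i\<^esub>\<close> is written \<open>k i\<close>.\<close>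

definition kappa :: "(nat \<Rightarrow> 'n::finite) \<Rightarrow> (nat \<Rightarrow> real) \<Rightarrow> real^'n^'n" where
  "kappa e k = (\<Sum>i=1..CARD('n) div 2. k i *\<^sub>R wedge (axis (e (2*i - 1)) 1) (axis (e (2*i)) 1))"

text \<open>
  The forms \<open>\<omega>\<close> (canonical) and \<open>f\<close> (magnetic) have constant coefficients
  on the ambient space (so they, and their restrictions, are closed); the restriction to the cotangent bundle happens below, by
  evaluating them on tangent vectors only. The convention for the wedge product is
  \<open>(\<alpha> \<and> \<beta>)(u,v) = \<alpha>(u) \<beta>(v) - \<alpha>(v) \<beta>(u)\<close>.
\<close>

definition canonical_form :: "'n::finite phase \<Rightarrow> 'n phase \<Rightarrow> real" where
  "canonical_form u v = (\<Sum>i\<in>UNIV. snd u $ i * fst v $ i - snd v $ i * fst u $ i)"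

definition magnetic_form ::
  "(nat \<Rightarrow> 'n::finite) \<Rightarrow> real \<Rightarrow> real^'n^'n \<Rightarrow> 'n phase \<Rightarrow> 'n phase \<Rightarrow> real" where
  "magnetic_form e s K u v =
     s * (\<Sum>j=1..CARD('n). \<Sum>i\<in>{1..<j}. K $ e i $ e j *
       (fst u $ e i * fst v $ e j - fst v $ e i * fst u $ e j))"

definition twisted_form ::
  "(nat \<Rightarrow> 'n::finite) \<Rightarrow> real \<Rightarrow> real^'n^'n \<Rightarrow> 'n phase \<Rightarrow> 'n phase \<Rightarrow> real" where
  "twisted_form e s K u v = canonical_form u v + magnetic_form e s K u v"

text \<open>
  Functions on the phase space are given by functions on the ambient space; only the
  restriction of their differential to tangent vectors matters. With the sign convention
  \<open>\<Omega>(X\<^sub>f, \<cdot>) = -df\<close> one has \<open>\<gamma>' = \<partial>H/\<partial>p\<close> in the canonical case. Existence and uniqueness of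
  the vector described here is lemma \<open>hamiltonian_vector_ex1\<close> below.
\<close>

definition hamiltonian_vf ::
  "(nat \<Rightarrow> 'n::finite) \<Rightarrow> real \<Rightarrow> real^'n^'n \<Rightarrow> ('n phase \<Rightarrow> real) \<Rightarrow> 'n phase \<Rightarrow> 'n phase" where
  "hamiltonian_vf e s K f x =
     (THE X. X \<in> tangent_at x \<and>
        (\<forall>v\<in>tangent_at x. twisted_form e s K X v = - frechet_derivative f (at x) v))"

definition poisson_bracket ::
  "(nat \<Rightarrow> 'n::finite) \<Rightarrow> real \<Rightarrow> real^'n^'n \<Rightarrow> ('n phase \<Rightarrow> real) \<Rightarrow> ('n phase \<Rightarrow> real)
     \<Rightarrow> 'n phase \<Rightarrow> real" where
  "poisson_bracket e s K f g x =
     twisted_form e s K (hamiltonian_vf e s K f x) (hamiltonian_vf e s K g x)"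


section \<open>Liouville integrability on the cotangent bundle of the sphere\<close>

definition first_integral :: "('n::finite phase \<Rightarrow> 'n phase) \<Rightarrow> ('n phase \<Rightarrow> real) \<Rightarrow> bool" where
  "first_integral X f \<longleftrightarrow>
     (\<forall>T c. is_interval T \<longrightarrow>
        (\<forall>t\<in>T. c t \<in> cotangent_sphere \<and> (c has_vector_derivative X (c t)) (at t within T)) \<longrightarrow>
        (\<forall>t\<in>T. \<forall>t'\<in>T. f (c t) = f (c t')))"

text \<open>Linear independence of the restricted differentials.\<close>

definition functionally_independent_at :: "'n::finite phase \<Rightarrow> ('n phase \<Rightarrow> real) set \<Rightarrow> bool" where
  "functionally_independent_at x S \<longleftrightarrow>
     (\<forall>c. (\<forall>v\<in>tangent_at x. (\<Sum>f\<in>S. c f * frechet_derivative f (at x) v) = 0)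
           \<longrightarrow> (\<forall>f\<in>S. c f = 0))"

text \<open>
  The Hamiltonian system of \<open>H\<close> is Liouville integrable by means of the functions in \<open>Fs\<close>;
  the phase space has dimension \<open>2 (n - 1)\<close>.
\<close>

definition liouville_integrable_by ::
  "(nat \<Rightarrow> 'n::finite) \<Rightarrow> real \<Rightarrow> real^'n^'n \<Rightarrow> ('n phase \<Rightarrow> real) \<Rightarrow> ('n phase \<Rightarrow> real) set \<Rightarrow> bool"
  where
  "liouville_integrable_by e s K H Fs \<longleftrightarrow>
     (\<forall>f\<in>Fs. \<forall>x\<in>cotangent_sphere. f differentiable (at x)) \<and>
     (\<forall>f\<in>Fs. first_integral (hamiltonian_vf e s K H) f) \<and>
     (\<forall>f\<in>Fs. \<forall>g\<in>Fs. \<forall>x\<in>cotangent_sphere. poisson_bracket e s K f g x = 0) \<and>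
     (\<exists>S\<subseteq>Fs. card S = CARD('n) - 1 \<and>
        (\<exists>U. openin (top_of_set cotangent_sphere) U \<and> cotangent_sphere \<subseteq> closure U \<and>
             (\<forall>x\<in>U. functionally_independent_at x S)))"


section \<open>The magnetic flow and its integrals\<close>

definition kinetic_energy :: "'n::finite phase \<Rightarrow> real" where
  "kinetic_energy x = (1/2) * (snd x \<bullet> snd x)"

definition magnetic_vf :: "real \<Rightarrow> real^'n^'n \<Rightarrow> 'n::finite phase \<Rightarrow> 'n phase" where
  "magnetic_vf s K x =
     (let \<gamma> = fst x; p = snd x; \<mu> = s * (p \<bullet> (K *v \<gamma>)) - p \<bullet> p
      in (p, s *\<^sub>R (K *v p) + \<mu> *\<^sub>R \<gamma>))"

definition Phi :: "(nat \<Rightarrow> 'n::finite) \<Rightarrow> real \<Rightarrow> (nat \<Rightarrow> real) \<Rightarrow> nat \<Rightarrow> 'n phase \<Rightarrow> real" where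
  "Phi e s k i x =
     (let \<gamma> = fst x; p = snd x in
        \<gamma> $ e (2*i - 1) * p $ e (2*i) - \<gamma> $ e (2*i) * p $ e (2*i - 1)
        + s * k i / 2 * ((\<gamma> $ e (2*i - 1))\<^sup>2 + (\<gamma> $ e (2*i))\<^sup>2))"

text \<open>
  For odd \<open>n = 2 l - 1\<close> the missing coordinate number \<open>2 l\<close> and the missing parameter number \<open>l\<close>
  are zero.
\<close>

definition coord :: "(nat \<Rightarrow> 'n::finite) \<Rightarrow> real^'n \<Rightarrow> nat \<Rightarrow> real" where
  "coord e x j = (if j \<le> CARD('n) then x $ e j else 0)"

definition kpar :: "(nat \<Rightarrow> 'n::finite) \<Rightarrow> (nat \<Rightarrow> real) \<Rightarrow> nat \<Rightarrow> real" where
  "kpar e k i = (if i \<le> CARD('n) div 2 then k i else 0)"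

text \<open>This is \<open>z\<^sub>i\<close> for the \<open>\<gamma>\<close>-part and \<open>w\<^sub>i\<close> for the \<open>p\<close>-part.\<close>

definition zcoord :: "(nat \<Rightarrow> 'n::finite) \<Rightarrow> real^'n \<Rightarrow> nat \<Rightarrow> complex" where
  "zcoord e x i = Complex (coord e x (2*i - 1)) (coord e x (2*i))"

definition apar :: "(nat \<Rightarrow> 'n::finite) \<Rightarrow> real \<Rightarrow> (nat \<Rightarrow> real) \<Rightarrow> nat \<Rightarrow> real" where
  "apar e s k i = s\<^sup>2 / 16 * (kpar e k i)\<^sup>2"

definition phi ::
  "(nat \<Rightarrow> 'n::finite) \<Rightarrow> real \<Rightarrow> (nat \<Rightarrow> real) \<Rightarrow> nat \<Rightarrow> nat \<Rightarrow> 'n phase \<Rightarrow> complex" where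
  "phi e s k i j x =
     (let z = zcoord e (fst x); w = zcoord e (snd x) in
        1/2 * (w i * cnj (z j) - z i * cnj (w j))
        + \<i> * of_real (s/4 * (kpar e k i + kpar e k j)) * z i * cnj (z j))"

definition F_integral ::
  "(nat \<Rightarrow> 'n::finite) \<Rightarrow> real \<Rightarrow> (nat \<Rightarrow> real) \<Rightarrow> nat \<Rightarrow> 'n phase \<Rightarrow> real" where
  "F_integral e s k i x =
     (\<Sum>j\<in>{1..(CARD('n) + 1) div 2} - {i}.
        (cmod (phi e s k i j x))\<^sup>2 / (apar e s k i - apar e s k j))
     + (cmod (zcoord e (fst x) i))\<^sup>2"


section \<open>Hamiltonian vector fields are well defined\<close>

lemma kappa_skew: "kappa e k $ i $ j = - kappa e k $ j $ i"
  by (simp add: kappa_def wedge_def sum_negf[symmetric] algebra_simps)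

lemma magnetic_form_skew_matrix:
  fixes K :: "real^'n::finite^'n"
  assumes e: "bij_betw e {1..CARD('n)} UNIV" and K: "\<And>i j. K $ i $ j = - K $ j $ i"
  shows "magnetic_form e s K u v = - s * ((K *v fst u) \<bullet> fst v)"
proof -
  let ?N = "{1..CARD('n)}"
  let ?g = "\<lambda>i j. K $ e i $ e j * (fst u $ e i * fst v $ e j)"
  have diag: "K $ i $ i = 0" for i using K[of i i] by simp
  have re: "(\<Sum>j\<in>UNIV. h j) = (\<Sum>j\<in>?N. h (e j))" for h :: "'n \<Rightarrow> real"
    using sum.reindex_bij_betw[OF e, of h] by simp
  have split: "(\<Sum>i\<in>?N. ?g i j) = (\<Sum>i\<in>{1..<j}. ?g i j) + (\<Sum>i\<in>{j<..CARD('n)}. ?g i j)"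
    if j: "j \<in> ?N" for j
  proof -
    have "?N = {1..<j} \<union> ({j} \<union> {j<..CARD('n)})" using j by auto
    then have "(\<Sum>i\<in>?N. ?g i j) = (\<Sum>i\<in>{1..<j}. ?g i j) + (\<Sum>i\<in>{j} \<union> {j<..CARD('n)}. ?g i j)"
      by (simp only:) (subst sum.union_disjoint, auto)
    then show ?thesis by (simp add: diag)
  qed
  have swap: "(\<Sum>j\<in>?N. \<Sum>i\<in>{j<..CARD('n)}. ?g i j) = (\<Sum>i\<in>?N. \<Sum>j\<in>{1..<i}. ?g i j)"
  proof -
    have "{j<..CARD('n)} = {i \<in> ?N. j < i}" if "j \<in> ?N" for j using that by auto
    then have "(\<Sum>j\<in>?N. \<Sum>i\<in>{j<..CARD('n)}. ?g i j) = (\<Sum>j\<in>?N. \<Sum>i\<in>{i \<in> ?N. j < i}. ?g i j)"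
      by (intro sum.cong) auto
    also have "\<dots> = (\<Sum>i\<in>?N. \<Sum>j\<in>{j \<in> ?N. j < i}. ?g i j)"
      by (rule sum.swap_restrict) auto
    also have "\<dots> = (\<Sum>i\<in>?N. \<Sum>j\<in>{1..<i}. ?g i j)"
      by (intro sum.cong) auto
    finally show ?thesis .
  qed
  have "(K *v fst u) \<bullet> fst v = (\<Sum>j\<in>?N. \<Sum>i\<in>?N. K $ e j $ e i * fst u $ e i * fst v $ e j)"
    by (simp add: inner_vec_def matrix_vector_mult_def sum_distrib_right re)
  also have "\<dots> = - (\<Sum>j\<in>?N. \<Sum>i\<in>?N. ?g i j)"
  proof -
    have "K $ e j $ e i * fst u $ e i * fst v $ e j = - ?g i j" for i j
      using K[of "e j" "e i"] by simp
    then show ?thesis by (simp add: sum_negf)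
  qed
  also have "(\<Sum>j\<in>?N. \<Sum>i\<in>?N. ?g i j)
      = (\<Sum>j\<in>?N. \<Sum>i\<in>{1..<j}. ?g i j) + (\<Sum>i\<in>?N. \<Sum>j\<in>{1..<i}. ?g i j)"
    using split swap by (simp add: sum.distrib)
  also have "\<dots> = (\<Sum>j\<in>?N. \<Sum>i\<in>{1..<j}. K $ e i $ e j *
       (fst u $ e i * fst v $ e j - fst v $ e i * fst u $ e j))"
    unfolding sum.distrib[symmetric]
  proof (intro sum.cong refl)
    fix j i
    show "?g i j + ?g j i
      = K $ e i $ e j * (fst u $ e i * fst v $ e j - fst v $ e i * fst u $ e j)"
      using K[of "e j" "e i"] by (simp add: algebra_simps)
  qed
  finally show ?thesis by (simp add: magnetic_form_def)
qed

lemma canonical_form_inner: "canonical_form u v = snd u \<bullet> fst v - fst u \<bullet> snd v"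
  by (simp add: canonical_form_def inner_vec_def sum_subtractf mult.commute)

lemma hamiltonian_vector_ex1:
  fixes x :: "'n::finite phase" and L :: "'n phase \<Rightarrow> real"
  assumes e: "bij_betw e {1..CARD('n)} UNIV" and K: "\<And>i j. K $ i $ j = - K $ j $ i"
    and x: "x \<in> cotangent_sphere" and L: "linear L"
  shows "\<exists>!X. X \<in> tangent_at x \<and> (\<forall>v\<in>tangent_at x. twisted_form e s K X v = - L v)"
proof -
  obtain g p where x_eq: "x = (g, p)" by (cases x)
  have gg: "g \<bullet> g = 1" and pg: "p \<bullet> g = 0" using x by (auto simp: x_eq cotangent_sphere_def)
  have tan: "(u, v) \<in> tangent_at x \<longleftrightarrow> g \<bullet> u = 0 \<and> v \<bullet> g + p \<bullet> u = 0" for u v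
    by (simp add: x_eq tangent_at_def)
  have form: "twisted_form e s K (X, Y) (u, v) = Y \<bullet> u - X \<bullet> v - s * ((K *v X) \<bullet> u)"
    for X Y u v
    by (simp add: twisted_form_def canonical_form_inner magnetic_form_skew_matrix[OF e K])
  define ab where "ab = adjoint L 1"
  obtain a b where ab: "ab = (a, b)" by (cases ab)
  have "L w = w \<bullet> ab" for w
    using adjoint_works[OF L, of w 1] by (simp add: ab_def inner_commute)
  then have Lab: "L (u, v) = a \<bullet> u + b \<bullet> v" for u v
    by (simp add: ab inner_commute)
  define X where "X = b - (b \<bullet> g) *\<^sub>R g"
  define Y0 where "Y0 = s *\<^sub>R (K *v X) - a + (b \<bullet> g) *\<^sub>R p"
  define Y where "Y = Y0 - (X \<bullet> p + Y0 \<bullet> g) *\<^sub>R g"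
  have Xg: "g \<bullet> X = 0" by (simp add: X_def inner_diff_right gg inner_commute)
  have tXY: "(X, Y) \<in> tangent_at x"
    using Xg gg by (simp add: tan Y_def inner_diff_left inner_commute[of X p])
  have sol: "twisted_form e s K (X, Y) (u, v) = - L (u, v)" if t: "(u, v) \<in> tangent_at x" for u v
  proof -
    have gu: "g \<bullet> u = 0" and vg: "g \<bullet> v = - (p \<bullet> u)"
      using t by (auto simp: tan inner_commute)
    have "Y \<bullet> u = s * ((K *v X) \<bullet> u) - a \<bullet> u + (b \<bullet> g) * (p \<bullet> u)"
      by (simp add: Y_def Y0_def inner_diff_left inner_add_left gu)
    moreover have "X \<bullet> v = b \<bullet> v + (b \<bullet> g) * (p \<bullet> u)"
      by (simp add: X_def inner_diff_left vg)
    ultimately show ?thesis by (simp add: form Lab)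
  qed
  have nondeg: "A = 0 \<and> B = 0"
    if t: "(A, B) \<in> tangent_at x"
      and z: "\<And>u v. (u, v) \<in> tangent_at x \<Longrightarrow> twisted_form e s K (A, B) (u, v) = 0" for A B
  proof -
    have gA: "g \<bullet> A = 0" using t by (simp add: tan)
    have "twisted_form e s K (A, B) (0, A) = 0"
      by (rule z) (use gA in \<open>simp add: tan inner_commute\<close>)
    then have A: "A = 0" by (simp add: form)
    have gB: "B \<bullet> g = 0" using t A by (simp add: tan)
    have "twisted_form e s K (A, B) (B, - (p \<bullet> B) *\<^sub>R g) = 0"
      by (rule z) (use gB gg in \<open>simp add: tan inner_commute\<close>)
    then have "B = 0" by (simp add: form A)
    with A show ?thesis by simp
  qed
  show ?thesis
  proof (rule ex1I[of _ "(X, Y)"])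
    show "(X, Y) \<in> tangent_at x \<and> (\<forall>v\<in>tangent_at x. twisted_form e s K (X, Y) v = - L v)"
      using tXY sol by auto
  next
    fix Z assume Z: "Z \<in> tangent_at x \<and> (\<forall>v\<in>tangent_at x. twisted_form e s K Z v = - L v)"
    obtain Z1 Z2 where Zeq: "Z = (Z1, Z2)" by (cases Z)
    have "(Z1 - X, Z2 - Y) \<in> tangent_at x"
      using Z tXY unfolding Zeq by (auto simp: tan inner_diff_left inner_diff_right)
    moreover have "twisted_form e s K (Z1 - X, Z2 - Y) (u, v) = 0"
      if t: "(u, v) \<in> tangent_at x" for u v
    proof -
      have "twisted_form e s K (Z1, Z2) (u, v) = twisted_form e s K (X, Y) (u, v)"
        using Z t sol unfolding Zeq by auto
      then show ?thesis
        unfolding form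
        by (simp add: inner_diff_left matrix_vector_mult_diff_distrib algebra_simps)
    qed
    ultimately have "Z1 - X = 0 \<and> Z2 - Y = 0" by (rule nondeg)
    then show "Z = (X, Y)" by (simp add: Zeq)
  qed
qed

end

(*
  The magnetic term is absorbed into the momentum y = p - (s/2) kappa gamma, which turns the
  twisted form into the canonical one. Identify the i-th coordinate plane with the complex
  line and let z_i, w_i be the blocks of gamma, y. Then phi_ik = (w_i cnj(z_k) - z_i cnj(w_k))/2,
  and with X_i = |z_i|^2, Y_i = |w_i|^2, Z_i = <z_i,w_i>, Q_i = <sqrt(-1) z_i,w_i> = Phi_i,
    |phi_ik|^2 = (X_i Y_k + X_k Y_i - 2 Z_i Z_k)/4 + Q_i Q_k/2.
  For each i the functions X_i, Y_i, Z_i span a copy of sl(2), different copies commute, and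
  the Q_i are central, so the F_i are the Hamiltonians of a Gaudin model with an external field;
  they commute because 1/(a_i - a_r) satisfies the classical Yang-Baxter identity. Also
  2 H = sum_i (Y_i - s kappa_i Q_i + 4 a_i X_i), and sum X_i = 1, sum Z_i = 0 on the phase space.

  For independence it suffices to differentiate along the cotangent fibres. The directions that
  rescale the blocks z_i kill the differentials of all Phi_i and reduce a vanishing combination
  of the F_i to the kernel of a weighted graph Laplacian; the directions sqrt(-1) z_i then
  detect the Phi_i.
*)
theory Submission
  imports Defs
begin

section \<open>Preliminaries\<close>

text \<open>When \<open>n\<close> is odd the last pair contains the index \<open>n + 1\<close>,
  where \<open>f\<close> vanishes; this lets both parities share the same block sums.\<close>

lemma sum_pairs_odd_even:
  fixes f :: "nat \<Rightarrow> 'a::comm_monoid_add"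
  assumes "\<And>i. i > n \<Longrightarrow> f i = 0"
  shows "(\<Sum>i=1..n. f i) = (\<Sum>j=1..(n + 1) div 2. f (2*j - 1) + f (2*j))"
proof -
  have pairs: "(\<Sum>j=1..q. f (2*j - 1) + f (2*j)) = (\<Sum>i=1..2*q. f i)" for q
    by (induction q) (simp_all add: add.assoc)
  have "(\<Sum>i=1..n. f i) = (\<Sum>i=1..2 * ((n + 1) div 2). f i)"
    by (rule sum.mono_neutral_left) (use assms in auto)
  with pairs show ?thesis by simp
qed

text \<open>By the Leibniz formula the determinant is a polynomial in \<open>t\<close>, nonzero
  because its value at \<open>0\<close> is \<open>det A\<close>.\<close>

lemma finite_det_affine_zeros:
  fixes A B :: "real^'n::finite^'n"
  assumes "det A \<noteq> 0"
  shows "finite {t. det (A + t *\<^sub>R B) = 0}"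
proof -
  define q where "q = (\<Sum>p\<in>{p. p permutes (UNIV :: 'n set)}.
    smult (of_int (sign p)) (\<Prod>i\<in>UNIV. [:A $ i $ p i, B $ i $ p i:]))"
  have q: "poly q t = det (A + t *\<^sub>R B)" for t
    by (simp add: q_def det_def poly_sum poly_prod)
  have "poly q 0 \<noteq> 0" using assms by (simp add: q)
  then have "q \<noteq> 0" by auto
  then show ?thesis using poly_roots_finite[of q] by (simp add: q)
qed

lemma det_matrix_nz_iff:
  fixes f :: "real^'n::finite \<Rightarrow> real^'n"
  assumes "linear f"
  shows "det (matrix f) \<noteq> 0 \<longleftrightarrow> (\<forall>v. f v = 0 \<longrightarrow> v = 0)"
  by (metis assms det_nz_iff_inj linear_injective_0)

lemma eventually_at_notin_finite:
  fixes a :: "'a::t1_space"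
  assumes "finite S"
  shows "\<forall>\<^sub>F x in at a. x \<notin> S"
  using assms
  by (auto simp: eventually_at_filter eventually_nhds intro!: exI[of _ "- (S - {a})"] open_Compl finite_imp_closed)

text \<open>Indexing by coefficients avoids having to know beforehand that the functions are distinct.\<close>

lemma functionally_independent_image:
  assumes "finite I"
    and ind: "\<And>c. (\<And>v. v \<in> tangent_at x \<Longrightarrow>
           (\<Sum>i\<in>I. c i * frechet_derivative (g i) (at x) v) = 0) \<Longrightarrow> \<forall>i\<in>I. c i = (0::real)"
  shows "inj_on g I" and "functionally_independent_at x (g ` I)"
proof -
  show inj: "inj_on g I"
  proof (rule inj_onI, rule ccontr)
    fix i j assume ij: "i \<in> I" "j \<in> I" "g i = g j" "i \<noteq> j"
    \<comment> \<open>If two indices gave the same function, the difference of their indicators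
      would be a nontrivial vanishing relation.\<close>
    define c where "c = (\<lambda>r. of_bool (r = i) - (of_bool (r = j) :: real))"
    have "\<forall>i\<in>I. c i = 0"
    proof (rule ind)
      fix v
      have "(\<Sum>r\<in>I. c r * frechet_derivative (g r) (at x) v) =
        (\<Sum>r\<in>I. (if r = i then frechet_derivative (g r) (at x) v else 0)) -
        (\<Sum>r\<in>I. (if r = j then frechet_derivative (g r) (at x) v else 0))"
        unfolding sum_subtractf[symmetric] by (intro sum.cong) (auto simp: c_def)
      also have "\<dots> = 0" using ij assms(1) by simp
      finally show "(\<Sum>r\<in>I. c r * frechet_derivative (g r) (at x) v) = 0" .
    qed
    with ij show False by (auto simp: c_def)
  qed
  show "functionally_independent_at x (g ` I)"
    unfolding functionally_independent_at_def
  proof (intro allI impI ballI)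
    fix c f assume c: "\<forall>v\<in>tangent_at x. (\<Sum>f\<in>g ` I. c f * frechet_derivative f (at x) v) = 0"
      and f: "f \<in> g ` I"
    have "\<forall>i\<in>I. (c \<circ> g) i = 0"
    proof (rule ind[of "c \<circ> g"])
      fix v assume "v \<in> tangent_at x"
      then have "(\<Sum>f\<in>g ` I. c f * frechet_derivative f (at x) v) = 0" using c by blast
      then show "(\<Sum>i\<in>I. (c \<circ> g) i * frechet_derivative (g i) (at x) v) = 0"
        by (simp add: sum.reindex[OF inj])
    qed
    with f show "c f = 0" by auto
  qed
qed

text \<open>\<open>at 0\<close> is punctured, so the curve only has to lie in \<open>U\<close> after
  leaving its starting point; both density proofs perturb a point in this way.\<close>

lemma in_closureI_path:
  fixes c :: "real \<Rightarrow> 'a::topological_space"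
  assumes "isCont c 0" "\<forall>\<^sub>F t in at 0. c t \<in> U"
  shows "c 0 \<in> closure U"
proof (rule Lim_in_closed_set[OF closed_closure])
  show "\<forall>\<^sub>F t in at 0. c t \<in> closure U"
    using assms(2) by (rule eventually_mono) (use closure_subset in blast)
qed (use assms(1) in \<open>simp_all add: isCont_def\<close>)

text \<open>Along an integral curve \<open>f\<close> has derivative zero by the chain rule, taken
  within \<open>T\<close> so that end points of the interval are covered.\<close>

lemma first_integralI:
  assumes diff: "\<And>x. x \<in> cotangent_sphere \<Longrightarrow> f differentiable (at x)"
    and zero: "\<And>x. x \<in> cotangent_sphere \<Longrightarrow> frechet_derivative f (at x) (V x) = 0"
  shows "first_integral V f"
  unfolding first_integral_def
proof (intro allI impI ballI)
  fix T :: "real set" and c t t'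
  assume T: "is_interval T"
    and c: "\<forall>t\<in>T. c t \<in> cotangent_sphere \<and> (c has_vector_derivative V (c t)) (at t within T)"
    and t: "t \<in> T" "t' \<in> T"
  have "((f \<circ> c) has_vector_derivative 0) (at t within T)" if "t \<in> T" for t
  proof -
    have "c t \<in> cotangent_sphere" and ct: "(c has_vector_derivative V (c t)) (at t within T)"
      using c that by auto
    then have "(f has_derivative frechet_derivative f (at (c t))) (at (c t) within c ` T)"
      using diff frechet_derivative_works has_derivative_at_withinI by blast
    from vector_derivative_diff_chain_within[OF ct this] show ?thesis
      using zero[OF \<open>c t \<in> cotangent_sphere\<close>] by simp
  qed
  then obtain d where "\<forall>t\<in>T. (f \<circ> c) t = d"
    using has_vector_derivative_zero_constant[OF is_interval_convex[OF T]] by metis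
  then show "f (c t) = f (c t')" using t by simp
qed

text \<open>Squaring is injective on the nonnegative parameters. In odd dimension the extra last
  block has parameter zero, and the assumption that all others are nonzero keeps it apart.\<close>

lemma apar_inj_on:
  fixes e :: "nat \<Rightarrow> 'n::finite" and k :: "nat \<Rightarrow> real"
  assumes "s \<noteq> 0" and pos: "\<And>i. i \<in> {1..CARD('n) div 2} \<Longrightarrow> k i \<ge> 0"
    and inj: "inj_on k {1..CARD('n) div 2}"
    and odd: "odd CARD('n) \<Longrightarrow> \<forall>i\<in>{1..CARD('n) div 2}. k i \<noteq> 0"
  shows "inj_on (apar e s k) {1..(CARD('n) + 1) div 2}"
proof (rule inj_onI)
  fix i j assume i: "i \<in> {1..(CARD('n) + 1) div 2}" and j: "j \<in> {1..(CARD('n) + 1) div 2}"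
    and "apar e s k i = apar e s k j"
  then have "(kpar e k i)\<^sup>2 = (kpar e k j)\<^sup>2" using assms(1) by (simp add: apar_def)
  moreover have "kpar e k r \<ge> 0" if "r \<in> {1..(CARD('n) + 1) div 2}" for r
    using pos[of r] that by (simp add: kpar_def)
  ultimately have eq: "kpar e k i = kpar e k j"
    using i j by (meson power2_eq_iff_nonneg)
  have last: "odd CARD('n) \<and> r = (CARD('n) + 1) div 2"
    if "r \<in> {1..(CARD('n) + 1) div 2}" "r \<notin> {1..CARD('n) div 2}" for r
    using that unfolding atLeastAtMost_iff by presburger
  have val: "kpar e k r = (if r \<in> {1..CARD('n) div 2} then k r else 0)" if "1 \<le> r" for r
    using that by (simp add: kpar_def)
  show "i = j"
  proof (cases "i \<in> {1..CARD('n) div 2}"; cases "j \<in> {1..CARD('n) div 2}")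
    assume "i \<in> {1..CARD('n) div 2}" "j \<in> {1..CARD('n) div 2}"
    then show "i = j" using eq val[of i] val[of j] i j inj_onD[OF inj] by auto
  next
    assume *: "i \<in> {1..CARD('n) div 2}" "j \<notin> {1..CARD('n) div 2}"
    then show "i = j" using eq val[of i] val[of j] i j odd last[OF j] by auto
  next
    assume *: "i \<notin> {1..CARD('n) div 2}" "j \<in> {1..CARD('n) div 2}"
    then show "i = j" using eq val[of i] val[of j] i j odd last[OF i] by auto
  next
    assume "i \<notin> {1..CARD('n) div 2}" "j \<notin> {1..CARD('n) div 2}"
    then show "i = j" using last[OF i] last[OF j] by simp
  qed
qed


section \<open>Complex block coordinates\<close>

locale magnetic_sphere =
  fixes e :: "nat \<Rightarrow> 'n::finite" and s :: real and k :: "nat \<Rightarrow> real" and l m :: nat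
  assumes m: "m = CARD('n) div 2" and l: "l = (CARD('n) + 1) div 2"
    and e: "bij_betw e {1..CARD('n)} UNIV"
begin

declare One_nat_def [simp del]

abbreviation K :: "real^'n^'n" where "K \<equiv> kappa e k"
abbreviation zc :: "real^'n \<Rightarrow> nat \<Rightarrow> complex" where "zc \<equiv> zcoord e"

lemma e_eq_iff: "i \<in> {1..CARD('n)} \<Longrightarrow> j \<in> {1..CARD('n)} \<Longrightarrow> e i = e j \<longleftrightarrow> i = j"
  using bij_betw_imp_inj_on[OF e] by (rule inj_on_eq_iff)

lemma sum_coordinates: "(\<Sum>a\<in>UNIV. f a) = (\<Sum>i=1..CARD('n). f (e i))"
  for f :: "'n \<Rightarrow> 'b::comm_monoid_add"
  using sum.reindex_bij_betw[OF e, of f] by simp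

lemma zc_add: "zc (u + v) j = zc u j + zc v j"
  and zc_diff: "zc (u - v) j = zc u j - zc v j"
  and zc_scaleR: "zc (c *\<^sub>R u) j = c *\<^sub>R zc u j"
  and zc_zero: "zc 0 j = 0"
  by (simp_all add: zcoord_def coord_def complex_eq_iff)

lemmas zc_linear = zc_add zc_diff zc_scaleR zc_zero

lemma bounded_linear_zc: "bounded_linear (\<lambda>u. zc u j)"
  by (intro linear_conv_bounded_linear[THEN iffD1] linearI) (simp_all add: zc_linear)

lemma zc_real: "j \<notin> {1..m} \<Longrightarrow> j \<in> {1..l} \<Longrightarrow> Im (zc u j) = 0"
  by (simp add: zcoord_def coord_def m)

lemma inner_zc: "u \<bullet> v = (\<Sum>j\<in>{1..l}. zc u j \<bullet> zc v j)"
proof -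
  have "u \<bullet> v = (\<Sum>i=1..CARD('n). u $ e i * v $ e i)"
    by (simp add: inner_vec_def sum_coordinates)
  also have "\<dots> = (\<Sum>i=1..CARD('n). coord e u i * coord e v i)"
    by (intro sum.cong) (auto simp: m l coord_def)
  also have "\<dots> = (\<Sum>j\<in>{1..l}. zc u j \<bullet> zc v j)"
    unfolding l inner_complex_def zcoord_def complex.sel
    by (rule sum_pairs_odd_even) (simp add: coord_def)
  finally show ?thesis .
qed

text \<open>A right inverse of \<open>zc\<close> up to the missing coordinate: imaginary parts are
  placed only up to \<open>m\<close>, since in odd dimension the last block is a real line.\<close>

definition assemble :: "(nat \<Rightarrow> complex) \<Rightarrow> real^'n" where
  "assemble A = (\<Sum>j=1..l. Re (A j) *\<^sub>R axis (e (2*j - 1)) 1)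
     + (\<Sum>j=1..m. Im (A j) *\<^sub>R axis (e (2*j)) 1)"

lemma e_block_eq_iff:
  assumes "j \<in> {1..l}"
  shows "i \<in> {1..l} \<Longrightarrow> e (2*j - 1) = e (2*i - 1) \<longleftrightarrow> i = j"
    and "i \<in> {1..m} \<Longrightarrow> e (2*j - 1) \<noteq> e (2*i)"
proof -
  show "e (2*j - 1) = e (2*i - 1) \<longleftrightarrow> i = j" if i: "i \<in> {1..l}"
  proof -
    have "2*j - 1 \<in> {1..CARD('n)}" "2*i - 1 \<in> {1..CARD('n)}"
      using assms i unfolding l atLeastAtMost_iff by presburger+
    then have "e (2*j - 1) = e (2*i - 1) \<longleftrightarrow> 2*j - 1 = 2*i - 1" by (rule e_eq_iff)
    then show ?thesis using assms i by auto
  qed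
  show "e (2*j - 1) \<noteq> e (2*i)" if i: "i \<in> {1..m}"
  proof -
    have "2*j - 1 \<in> {1..CARD('n)}" "2*i \<in> {1..CARD('n)}"
      using assms i unfolding l m atLeastAtMost_iff by presburger+
    then have "e (2*j - 1) = e (2*i) \<longleftrightarrow> 2*j - 1 = 2*i" by (rule e_eq_iff)
    moreover have "2*j - 1 \<noteq> 2*i" using assms unfolding atLeastAtMost_iff by presburger
    ultimately show ?thesis by blast
  qed
qed

lemma e_even_eq_iff:
  assumes "j \<in> {1..m}" "i \<in> {1..m}"
  shows "e (2*j) = e (2*i) \<longleftrightarrow> i = j"
proof -
  have "2*j \<in> {1..CARD('n)}" "2*i \<in> {1..CARD('n)}"
    using assms unfolding m atLeastAtMost_iff by presburger+
  then have "e (2*j) = e (2*i) \<longleftrightarrow> 2*j = 2*i" by (rule e_eq_iff)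
  then show ?thesis by auto
qed

lemma m_le_l: "j \<in> {1..m} \<Longrightarrow> j \<in> {1..l}"
  unfolding m l atLeastAtMost_iff by presburger

lemma zcoord_components:
  assumes "j \<in> {1..l}"
  shows "zc u j = Complex (u $ e (2*j - 1)) (if j \<in> {1..m} then u $ e (2*j) else 0)"
proof -
  have "2*j - 1 \<le> CARD('n)" "2*j \<le> CARD('n) \<longleftrightarrow> j \<in> {1..m}"
    using assms unfolding l m atLeastAtMost_iff by presburger+
  then show ?thesis by (simp add: zcoord_def coord_def)
qed

text \<open>In odd dimension the last block is a line, hence the real part.\<close>

lemma zc_assemble:
  assumes j: "j \<in> {1..l}"
  shows "zc (assemble A) j = (if j \<in> {1..m} then A j else of_real (Re (A j)))"
proof -
  have re: "assemble A $ e (2*j - 1) = Re (A j)"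
  proof -
    have "(\<Sum>i=1..l. Re (A i) *\<^sub>R axis (e (2*i - 1)) (1::real)) $ e (2*j - 1)
        = (\<Sum>i=1..l. if i = j then Re (A i) else 0)"
      unfolding sum_component
      by (intro sum.cong refl) (simp add: axis_def e_block_eq_iff(1)[OF j])
    moreover have "(\<Sum>i=1..m. Im (A i) *\<^sub>R axis (e (2*i)) (1::real)) $ e (2*j - 1) = 0"
      unfolding sum_component
      by (intro sum.neutral) (simp add: axis_def e_block_eq_iff(2)[OF j])
    ultimately show ?thesis using j by (simp add: assemble_def)
  qed
  have im: "assemble A $ e (2*j) = Im (A j)" if j2: "j \<in> {1..m}"
  proof -
    have "(\<Sum>i=1..m. Im (A i) *\<^sub>R axis (e (2*i)) (1::real)) $ e (2*j)
        = (\<Sum>i=1..m. if i = j then Im (A i) else 0)"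
      unfolding sum_component
      by (intro sum.cong refl) (simp add: axis_def e_even_eq_iff[OF j2])
    moreover have "(\<Sum>i=1..l. Re (A i) *\<^sub>R axis (e (2*i - 1)) (1::real)) $ e (2*j) = 0"
      unfolding sum_component
      by (intro sum.neutral) (simp add: axis_def e_block_eq_iff(2)[OF _ j2, symmetric, THEN not_sym] e_block_eq_iff(2)[OF _ j2, THEN not_sym])
    ultimately show ?thesis using j2 by (simp add: assemble_def)
  qed
  show ?thesis
    using j re im by (auto simp: zcoord_components complex_eq_iff)
qed

text \<open>\<open>assemble\<close> is the adjoint of \<open>zc\<close>: an imaginary part dropped
  in the last block would be paired with zero.\<close>

lemma assemble_inner: "assemble A \<bullet> v = (\<Sum>j\<in>{1..l}. A j \<bullet> zc v j)"
  unfolding inner_zc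
  by (intro sum.cong refl) (simp add: zc_assemble inner_complex_def zc_real del: atLeastAtMost_iff)

lemma kappa_mult: "K *v u = (\<Sum>i=1..m.
    k i *\<^sub>R (u $ e (2*i) *\<^sub>R axis (e (2*i - 1)) 1 - u $ e (2*i - 1) *\<^sub>R axis (e (2*i)) 1))"
proof -
  have w: "wedge x y *v u = (y \<bullet> u) *\<^sub>R x - (x \<bullet> u) *\<^sub>R y" for x y :: "real^'n"
    by (simp add: vec_eq_iff matrix_vector_mult_def wedge_def inner_vec_def sum_distrib_right
        sum_distrib_left sum_subtractf algebra_simps)
  have add: "(\<Sum>i\<in>I. M i) *v u = (\<Sum>i\<in>I. M i *v u)" for I and M :: "nat \<Rightarrow> real^'n^'n"
    by (induction I rule: infinite_finite_induct) (simp_all add: matrix_vector_mult_add_rdistrib)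
  show ?thesis
    by (simp add: kappa_def m add scaleR_matrix_vector_assoc[symmetric] w inner_axis inner_commute[of _ u])
qed

text \<open>On the plane of block \<open>j\<close> the matrix sends \<open>(a, b)\<close> to
  \<open>(k j * b, - k j * a)\<close>, which is multiplication by \<open>- \<i> * k j\<close>; a
  single last coordinate is annihilated, and \<open>kpar\<close> is zero there.\<close>

lemma zc_kappa:
  assumes "j \<in> {1..l}"
  shows "zc (K *v u) j = - \<i> * of_real (kpar e k j) * zc u j"
proof -
  have "K *v u = assemble (\<lambda>i. - \<i> * of_real (kpar e k i) * zc u i)"
  proof -
    have "(\<Sum>j\<in>{1..l}. Re (- \<i> * of_real (kpar e k j) * zc u j) *\<^sub>R axis (e (2*j - 1)) (1::real))
      = (\<Sum>j=1..m. (k j * u $ e (2*j)) *\<^sub>R axis (e (2*j - 1)) 1)"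
      by (rule sum.mono_neutral_cong_right)
        (use m_le_l in \<open>auto simp: kpar_def zcoord_components m[symmetric]\<close>)
    moreover have "(\<Sum>j=1..m. Im (- \<i> * of_real (kpar e k j) * zc u j) *\<^sub>R axis (e (2*j)) (1::real))
      = (\<Sum>j=1..m. - ((k j * u $ e (2*j - 1)) *\<^sub>R axis (e (2*j)) 1))"
      by (rule sum.cong)
        (use m_le_l in \<open>auto simp: kpar_def zcoord_components m[symmetric]\<close>)
    ultimately show ?thesis
      unfolding assemble_def kappa_mult
      by (simp only: sum_negf sum_subtractf scaleR_diff_right scaleR_scaleR)
        (simp add: sum_subtractf)
  qed
  then show ?thesis
    using assms by (auto simp: zc_assemble kpar_def m[symmetric])
qed

lemma kappa_skew_inner: "(K *v u) \<bullet> v = - (u \<bullet> (K *v v))"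
  unfolding inner_zc sum_negf[symmetric]
  by (intro sum.cong refl) (simp add: zc_kappa inner_complex_def)


section \<open>Hamiltonian vector fields in the shifted momentum\<close>

text \<open>Being linear, the shift is applied both to points and to tangent vectors.\<close>

definition mom :: "'n phase \<Rightarrow> real^'n" where
  "mom x = snd x - (s/2) *\<^sub>R (K *v fst x)"

lemma linear_mom: "linear mom"
  by (rule linearI)
    (simp_all add: mom_def matrix_vector_right_distrib matrix_vector_mult_scaleR algebra_simps)

text \<open>Skewness of \<open>K\<close> splits the magnetic term into two equal halves, one for
  each shifted momentum.\<close>

lemma twisted_form_mom: "twisted_form e s K U V = mom U \<bullet> fst V - fst U \<bullet> mom V"
  using kappa_skew_inner[of "fst U" "fst V"]
  by (simp add: twisted_form_def canonical_form_inner magnetic_form_skew_matrix[OF e kappa_skew]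
      mom_def inner_diff_left inner_diff_right)

text \<open>The two shift terms cancel by skewness of \<open>K\<close>, so the tangency conditions
  keep their form.\<close>

lemma tangent_at_mom:
  "V \<in> tangent_at x \<longleftrightarrow> fst x \<bullet> fst V = 0 \<and> mom V \<bullet> fst x + mom x \<bullet> fst V = 0"
  using kappa_skew_inner[of "fst x" "fst V"]
  by (simp add: tangent_at_def mom_def inner_diff_left inner_diff_right inner_commute case_prod_beta algebra_simps)

lemma hamiltonian_vf_eqI:
  assumes "x \<in> cotangent_sphere" "(f has_derivative L) (at x)" "V \<in> tangent_at x"
    and "\<And>v. v \<in> tangent_at x \<Longrightarrow> twisted_form e s K V v = - L v"
  shows "hamiltonian_vf e s K f x = V"
proof -
  have "frechet_derivative f (at x) = L"
    using assms(2) by (rule frechet_derivative_at[symmetric])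
  then show ?thesis
    unfolding hamiltonian_vf_def
    using hamiltonian_vector_ex1[OF e kappa_skew assms(1) has_derivative_linear[OF assms(2)]] assms(3,4)
    by (intro the1_equality) auto
qed

text \<open>
  The condition \<open>B \<bullet> \<gamma> = 0\<close> says that \<open>f\<close> commutes with \<open>\<langle>\<gamma>,\<gamma>\<rangle>\<close>; then the constraint
  only contributes a multiple of \<open>\<gamma>\<close> to the momentum part.
\<close>

lemma hamiltonian_vf_eq:
  assumes x: "x \<in> cotangent_sphere"
    and f: "(f has_derivative (\<lambda>h. A \<bullet> fst h + B \<bullet> mom h)) (at x)"
    and B: "B \<bullet> fst x = 0"
  defines "\<nu> \<equiv> mom x \<bullet> B - A \<bullet> fst x"
  shows "hamiltonian_vf e s K f x = (B, (s/2) *\<^sub>R (K *v B) - A - \<nu> *\<^sub>R fst x)"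
proof (rule hamiltonian_vf_eqI[OF x f])
  let ?V = "(B, (s/2) *\<^sub>R (K *v B) - A - \<nu> *\<^sub>R fst x)"
  have mom: "mom ?V = - A - \<nu> *\<^sub>R fst x" by (simp add: mom_def)
  have g: "fst x \<bullet> fst x = 1" using x by (auto simp: cotangent_sphere_def)
  \<comment> \<open>\<open>\<nu>\<close> is the Lagrange multiplier that makes the second tangency
    condition hold.\<close>
  show "?V \<in> tangent_at x"
    unfolding tangent_at_mom mom
    using B g by (simp add: inner_commute \<nu>_def inner_diff_left inner_diff_right)
  fix v assume "v \<in> tangent_at x"
  then have "fst x \<bullet> fst v = 0" by (simp add: tangent_at_mom)
  then show "twisted_form e s K ?V v = - (A \<bullet> fst v + B \<bullet> mom v)"
    unfolding twisted_form_mom mom by (simp add: inner_diff_left)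
qed

lemma mom_hamiltonian_vf:
  assumes "x \<in> cotangent_sphere" "(f has_derivative (\<lambda>h. A \<bullet> fst h + B \<bullet> mom h)) (at x)"
    and "B \<bullet> fst x = 0"
  obtains \<nu> where "fst (hamiltonian_vf e s K f x) = B"
    "mom (hamiltonian_vf e s K f x) = - A - \<nu> *\<^sub>R fst x"
  by (rule that[of "mom x \<bullet> B - A \<bullet> fst x"]) (simp_all add: hamiltonian_vf_eq[OF assms] mom_def)

text \<open>At fixed \<open>mom\<close> the energy depends on the position, with gradient
  \<open>- (s/2) *\<^sub>R (K *v snd x)\<close>. Together with the shift in the momentum component
  this gives the full force \<open>s *\<^sub>R (K *v snd x)\<close>.\<close>

lemma hamiltonian_vf_kinetic_energy:
  assumes x: "x \<in> cotangent_sphere"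
  shows "hamiltonian_vf e s K kinetic_energy x = magnetic_vf s K x"
proof -
  let ?A = "- (s/2) *\<^sub>R (K *v snd x)"
  have "(kinetic_energy has_derivative (\<lambda>h. ?A \<bullet> fst h + snd x \<bullet> mom h)) (at x)"
    unfolding kinetic_energy_def
  proof (rule derivative_eq_intros refl ext)+
    fix h :: "'n phase"
    show "1/2 * (snd x \<bullet> snd h + snd h \<bullet> snd x) = ?A \<bullet> fst h + snd x \<bullet> mom h"
      using kappa_skew_inner[of "snd x" "fst h"]
      by (simp add: mom_def inner_diff_right inner_commute[of "snd h"])
  qed
  moreover have "snd x \<bullet> fst x = 0" using x by (auto simp: cotangent_sphere_def)
  ultimately have "hamiltonian_vf e s K kinetic_energy x =
    (snd x, (s/2) *\<^sub>R (K *v snd x) - ?A - (mom x \<bullet> snd x - ?A \<bullet> fst x) *\<^sub>R fst x)"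
    using x by (rule hamiltonian_vf_eq[rotated])
  moreover have "mom x \<bullet> snd x - ?A \<bullet> fst x = snd x \<bullet> snd x - s * (snd x \<bullet> (K *v fst x))"
    using kappa_skew_inner[of "snd x" "fst x"]
    by (simp add: mom_def inner_diff_left inner_commute[of "K *v fst x"])
  moreover have "(s/2) *\<^sub>R (K *v snd x) - ?A = s *\<^sub>R (K *v snd x)"
    by (simp flip: scaleR_left.add)
  ultimately show ?thesis
    by (simp add: magnetic_vf_def Let_def scaleR_left_diff_distrib)
qed

section \<open>The functions of the complex blocks and their sl(2) brackets\<close>

abbreviation zx :: "'n phase \<Rightarrow> nat \<Rightarrow> complex" where "zx x \<equiv> zc (fst x)"
abbreviation wx :: "'n phase \<Rightarrow> nat \<Rightarrow> complex" where "wx x \<equiv> zc (mom x)"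

definition X :: "'n phase \<Rightarrow> nat \<Rightarrow> real" where "X x j = zx x j \<bullet> zx x j"
definition Y :: "'n phase \<Rightarrow> nat \<Rightarrow> real" where "Y x j = wx x j \<bullet> wx x j"
definition Z :: "'n phase \<Rightarrow> nat \<Rightarrow> real" where "Z x j = zx x j \<bullet> wx x j"
definition Q :: "'n phase \<Rightarrow> nat \<Rightarrow> real" where "Q x j = (\<i> * zx x j) \<bullet> wx x j"

lemma wx_eq: "j \<in> {1..l} \<Longrightarrow> wx x j = zc (snd x) j + \<i> * of_real (s/2 * kpar e k j) * zx x j"
  by (simp add: mom_def zc_linear zc_kappa complex_eq_iff)

text \<open>The quadratic term of \<open>Phi\<close> is what the shift of the momentum contributes,
  since \<open>\<i> * z\<close> is paired with \<open>\<i> * (s/2 * k j) * z\<close>.\<close>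

lemma Phi_eq_Q:
  assumes "j \<in> {1..m}"
  shows "Phi e s k j x = Q x j"
  using assms m_le_l[OF assms]
  unfolding Q_def wx_eq[OF m_le_l[OF assms]]
  by (simp add: Phi_def Let_def zcoord_components kpar_def m[symmetric]
      inner_complex_def power2_eq_square algebra_simps)

text \<open>The shift absorbs the \<open>z i * cnj (z j)\<close> term of \<open>phi\<close>. The
  mixed term of the squared modulus is the real part of a product of the two numbers
  \<open>w * cnj z\<close> of the blocks, whose real and imaginary parts are \<open>Z\<close> and
  \<open>Q\<close>.\<close>

lemma cmod_phi_eq:
  assumes "i \<in> {1..l}" "j \<in> {1..l}"
  shows "(cmod (phi e s k i j x))\<^sup>2 =
    (X x i * Y x j + X x j * Y x i - 2 * Z x i * Z x j) / 4 + Q x i * Q x j / 2"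
proof -
  have "phi e s k i j x = 1/2 * (wx x i * cnj (zx x j) - zx x i * cnj (wx x j))"
    using assms
    by (simp add: phi_def Let_def wx_eq complex_eq_iff field_simps)
  show ?thesis
    unfolding \<open>phi e s k i j x = _\<close> cmod_power2
    by (simp add: X_def Y_def Z_def Q_def inner_complex_def power2_eq_square field_simps)
qed

lemma F_integral_eq:
  assumes "i \<in> {1..l}"
  shows "F_integral e s k i x = (\<Sum>j\<in>{1..l} - {i}.
      ((X x i * Y x j + X x j * Y x i - 2 * Z x i * Z x j) / 4 + Q x i * Q x j / 2)
        / (apar e s k i - apar e s k j)) + X x i"
  unfolding F_integral_def l[symmetric]
  by (intro arg_cong2[of _ _ _ _ "(+)"] sum.cong)
    (use assms in \<open>simp_all add: cmod_phi_eq X_def dot_square_norm\<close>)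

lemma kinetic_energy_eq:
  "kinetic_energy x = (\<Sum>j=1..l. 1/2 * Y x j - s * kpar e k j / 2 * Q x j + 2 * apar e s k j * X x j)"
  unfolding kinetic_energy_def inner_zc sum_distrib_left
  by (intro sum.cong refl)
    (simp add: X_def Y_def Q_def wx_eq apar_def inner_complex_def power2_eq_square field_simps)

text \<open>This and \<open>grad_mom\<close> are the gradients in position and in shifted momentum.
  The minus sign before \<open>\<epsilon>\<close> comes from the skewness of multiplication by
  \<open>\<i>\<close>.\<close>

definition grad_pos :: "'n phase \<Rightarrow> (nat \<Rightarrow> real) \<Rightarrow> (nat \<Rightarrow> real) \<Rightarrow> (nat \<Rightarrow> real) \<Rightarrow> real^'n" where
  "grad_pos x \<alpha> \<delta> \<epsilon> = assemble (\<lambda>j. (2 * \<alpha> j) *\<^sub>R zx x j + \<delta> j *\<^sub>R wx x j - \<epsilon> j *\<^sub>R (\<i> * wx x j))"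

definition grad_mom :: "'n phase \<Rightarrow> (nat \<Rightarrow> real) \<Rightarrow> (nat \<Rightarrow> real) \<Rightarrow> (nat \<Rightarrow> real) \<Rightarrow> real^'n" where
  "grad_mom x \<beta> \<delta> \<epsilon> = assemble (\<lambda>j. (2 * \<beta> j) *\<^sub>R wx x j + \<delta> j *\<^sub>R zx x j + \<epsilon> j *\<^sub>R (\<i> * zx x j))"

text \<open>
  The arguments \<open>\<alpha>, \<beta>, \<delta>, \<epsilon>\<close> are the partial derivatives of \<open>f\<close> with respect to the
  block quantities \<open>X, Y, Z, Q\<close>.
\<close>

definition has_block_derivative where
  "has_block_derivative f x \<alpha> \<beta> \<delta> \<epsilon> \<longleftrightarrow>
     (f has_derivative (\<lambda>h. grad_pos x \<alpha> \<delta> \<epsilon> \<bullet> fst h + grad_mom x \<beta> \<delta> \<epsilon> \<bullet> mom h)) (at x)"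

definition DX where "DX x j h = 2 * (zx x j \<bullet> zx h j)"
definition DY where "DY x j h = 2 * (wx x j \<bullet> wx h j)"
definition DZ where "DZ x j h = wx x j \<bullet> zx h j + zx x j \<bullet> wx h j"
definition DQ where "DQ x j h = (\<i> * zx x j) \<bullet> wx h j - (\<i> * wx x j) \<bullet> zx h j"

lemma grad_inner:
  "grad_pos x \<alpha> \<delta> \<epsilon> \<bullet> fst h + grad_mom x \<beta> \<delta> \<epsilon> \<bullet> mom h =
    (\<Sum>j=1..l. \<alpha> j * DX x j h + \<beta> j * DY x j h + \<delta> j * DZ x j h + \<epsilon> j * DQ x j h)"
  unfolding grad_pos_def grad_mom_def assemble_inner sum.distrib[symmetric]
  by (intro sum.cong refl)
    (simp add: DX_def DY_def DZ_def DQ_def inner_add_left inner_diff_left algebra_simps)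

lemma has_block_derivativeI:
  assumes "(f has_derivative D) (at x)"
    and "\<And>h. D h = (\<Sum>j=1..l. \<alpha> j * DX x j h + \<beta> j * DY x j h + \<delta> j * DZ x j h + \<epsilon> j * DQ x j h)"
  shows "has_block_derivative f x \<alpha> \<beta> \<delta> \<epsilon>"
  using assms(1) unfolding has_block_derivative_def grad_inner assms(2)[abs_def] .

lemma frechet_derivative_block:
  assumes "has_block_derivative f x \<alpha> \<beta> \<delta> \<epsilon>"
  shows "frechet_derivative f (at x) h =
    (\<Sum>j=1..l. \<alpha> j * DX x j h + \<beta> j * DY x j h + \<delta> j * DZ x j h + \<epsilon> j * DQ x j h)"
  unfolding frechet_derivative_at[OF assms[unfolded has_block_derivative_def], symmetric]
  by (rule grad_inner)

lemma has_derivative_zx: "((\<lambda>x. zx x j) has_derivative (\<lambda>h. zx h j)) F"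
  by (rule bounded_linear.has_derivative[OF bounded_linear_zc has_derivative_fst[OF has_derivative_ident]])

lemma has_derivative_wx: "((\<lambda>x. wx x j) has_derivative (\<lambda>h. wx h j)) F"
  by (rule bounded_linear_imp_has_derivative)
    (rule bounded_linear_compose[OF bounded_linear_zc linear_mom[unfolded linear_conv_bounded_linear]])

lemma has_derivative_block_quantities:
  "((\<lambda>x. X x j) has_derivative DX x j) (at x)"
  "((\<lambda>x. Y x j) has_derivative DY x j) (at x)"
  "((\<lambda>x. Z x j) has_derivative DZ x j) (at x)"
  "((\<lambda>x. Q x j) has_derivative DQ x j) (at x)"
proof -
  show "((\<lambda>x. X x j) has_derivative DX x j) (at x)"
    unfolding X_def
    by (rule has_derivative_eq_rhs[OF has_derivative_inner[OF has_derivative_zx has_derivative_zx]])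
      (simp add: fun_eq_iff DX_def inner_commute)
  show "((\<lambda>x. Y x j) has_derivative DY x j) (at x)"
    unfolding Y_def
    by (rule has_derivative_eq_rhs[OF has_derivative_inner[OF has_derivative_wx has_derivative_wx]])
      (simp add: fun_eq_iff DY_def inner_commute)
  show "((\<lambda>x. Z x j) has_derivative DZ x j) (at x)"
    unfolding Z_def
    by (rule has_derivative_eq_rhs[OF has_derivative_inner[OF has_derivative_zx has_derivative_wx]])
      (simp add: fun_eq_iff DZ_def inner_commute)
  show "((\<lambda>x. Q x j) has_derivative DQ x j) (at x)"
    unfolding Q_def
    by (rule has_derivative_eq_rhs[OF has_derivative_inner
          [OF has_derivative_mult_right[OF has_derivative_zx] has_derivative_wx]])
      (simp add: fun_eq_iff DQ_def inner_complex_def)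
qed

lemma grad_mom_inner_zc:
  "grad_mom x \<beta> \<delta> \<epsilon> \<bullet> fst x = (\<Sum>j=1..l. 2 * \<beta> j * Z x j + \<delta> j * X x j)"
  unfolding grad_mom_def assemble_inner
  by (intro sum.cong refl) (simp add: Z_def X_def inner_complex_def algebra_simps)

text \<open>In each block the brackets of \<open>Y\<close> with \<open>X\<close>, \<open>Z\<close>
  with \<open>X\<close> and \<open>Y\<close> with \<open>Z\<close> are \<open>4 * Z\<close>,
  \<open>2 * X\<close> and \<open>2 * Y\<close>, the relations of sl(2). \<open>Q\<close> commutes
  with all three, so \<open>\<epsilon>\<close> disappears. A real last block is treated separately
  because \<open>assemble\<close> drops imaginary parts there.\<close>

lemma block_bracket:
  "grad_mom x \<beta> \<delta> \<epsilon> \<bullet> grad_pos x \<alpha>' \<delta>' \<epsilon>' - grad_pos x \<alpha> \<delta> \<epsilon> \<bullet> grad_mom x \<beta>' \<delta>' \<epsilon>' =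
    (\<Sum>j=1..l. 4 * Z x j * (\<beta> j * \<alpha>' j - \<alpha> j * \<beta>' j)
      + 2 * X x j * (\<delta> j * \<alpha>' j - \<alpha> j * \<delta>' j) + 2 * Y x j * (\<beta> j * \<delta>' j - \<delta> j * \<beta>' j))"
  unfolding inner_zc sum_subtractf[symmetric]
proof (intro sum.cong refl)
  fix j assume j: "j \<in> {1..l}"
  show "zc (grad_mom x \<beta> \<delta> \<epsilon>) j \<bullet> zc (grad_pos x \<alpha>' \<delta>' \<epsilon>') j
      - zc (grad_pos x \<alpha> \<delta> \<epsilon>) j \<bullet> zc (grad_mom x \<beta>' \<delta>' \<epsilon>') j =
    4 * Z x j * (\<beta> j * \<alpha>' j - \<alpha> j * \<beta>' j)
      + 2 * X x j * (\<delta> j * \<alpha>' j - \<alpha> j * \<delta>' j) + 2 * Y x j * (\<beta> j * \<delta>' j - \<delta> j * \<beta>' j)"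
  proof (cases "j \<in> {1..m}")
    case True
    with j show ?thesis
      by (simp add: grad_mom_def grad_pos_def zc_assemble X_def Y_def Z_def inner_complex_def
          algebra_simps)
  next
    case False
    then have "Im (zx x j) = 0" "Im (wx x j) = 0" using j by (simp_all only: zc_real not_False_eq_True)
    with j False show ?thesis
      by (simp add: grad_mom_def grad_pos_def zc_assemble X_def Y_def Z_def inner_complex_def
          algebra_simps)
  qed
qed

definition bracket_sum where
  "bracket_sum x \<alpha> \<beta> \<delta> \<alpha>' \<beta>' \<delta>' =
    (\<Sum>j=1..l. 4 * Z x j * (\<beta> j * \<alpha>' j - \<alpha> j * \<beta>' j)
      + 2 * X x j * (\<delta> j * \<alpha>' j - \<alpha> j * \<delta>' j) + 2 * Y x j * (\<beta> j * \<delta>' j - \<delta> j * \<beta>' j))"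

text \<open>The fields carry multiplier terms parallel to \<open>fst x\<close>, and the two sum
  conditions say that the momentum gradients are orthogonal to \<open>fst x\<close>; hence only the
  unconstrained block bracket remains.\<close>

lemma
  assumes x: "x \<in> cotangent_sphere"
    and f: "has_block_derivative f x \<alpha> \<beta> \<delta> \<epsilon>" "(\<Sum>j=1..l. 2 * \<beta> j * Z x j + \<delta> j * X x j) = 0"
    and g: "has_block_derivative g x \<alpha>' \<beta>' \<delta>' \<epsilon>'" "(\<Sum>j=1..l. 2 * \<beta>' j * Z x j + \<delta>' j * X x j) = 0"
  shows poisson_bracket_block: "poisson_bracket e s K f g x = bracket_sum x \<alpha> \<beta> \<delta> \<alpha>' \<beta>' \<delta>'"
    and frechet_derivative_hamiltonian_vf_block:
      "frechet_derivative f (at x) (hamiltonian_vf e s K g x) = - bracket_sum x \<alpha> \<beta> \<delta> \<alpha>' \<beta>' \<delta>'"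
proof -
  let ?A = "grad_pos x \<alpha> \<delta> \<epsilon>" and ?B = "grad_mom x \<beta> \<delta> \<epsilon>"
  let ?A' = "grad_pos x \<alpha>' \<delta>' \<epsilon>'" and ?B' = "grad_mom x \<beta>' \<delta>' \<epsilon>'"
  have B: "?B \<bullet> fst x = 0" "?B' \<bullet> fst x = 0" using f(2) g(2) by (simp_all add: grad_mom_inner_zc)
  note sum = block_bracket[of x \<beta> \<delta> \<epsilon> \<alpha>' \<delta>' \<epsilon>' \<alpha> \<beta>', folded bracket_sum_def]
  obtain \<nu> where 1: "fst (hamiltonian_vf e s K f x) = ?B"
    "mom (hamiltonian_vf e s K f x) = - ?A - \<nu> *\<^sub>R fst x"
    using mom_hamiltonian_vf[OF x f(1)[unfolded has_block_derivative_def] B(1)] .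
  obtain \<nu>' where 2: "fst (hamiltonian_vf e s K g x) = ?B'"
    "mom (hamiltonian_vf e s K g x) = - ?A' - \<nu>' *\<^sub>R fst x"
    using mom_hamiltonian_vf[OF x g(1)[unfolded has_block_derivative_def] B(2)] .
  show "poisson_bracket e s K f g x = bracket_sum x \<alpha> \<beta> \<delta> \<alpha>' \<beta>' \<delta>'"
    unfolding poisson_bracket_def twisted_form_mom 1 2 sum[symmetric]
    using B by (simp add: inner_diff_left inner_diff_right inner_commute[of "fst x"])
  show "frechet_derivative f (at x) (hamiltonian_vf e s K g x) = - bracket_sum x \<alpha> \<beta> \<delta> \<alpha>' \<beta>' \<delta>'"
    unfolding frechet_derivative_at[OF f(1)[unfolded has_block_derivative_def], symmetric] 2 sum[symmetric]
    using B by (simp add: inner_diff_right)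
qed

end


section \<open>Involution\<close>

text \<open>\<open>A\<close>, \<open>B\<close>, \<open>D\<close> hold the partial derivatives of the
  Gaudin Hamiltonians in \<open>X\<close>, \<open>Y\<close>, \<open>Z\<close>. Indices outside
  \<open>{i, j}\<close> contribute products \<open>G i r * G j r\<close>; the identity
  \<open>prod\<close> turns these into the single sums that also occur at \<open>i\<close> and
  \<open>j\<close>, where everything cancels.\<close>

lemma gaudin_bracket_zero:
  fixes a X Y Z :: "'a \<Rightarrow> real"
  assumes I: "finite I" "i \<in> I" "j \<in> I" "i \<noteq> j" and a: "inj_on a I"
  defines "G \<equiv> \<lambda>p q. 1 / (4 * (a p - a q))"
  defines "A \<equiv> \<lambda>i j. if j = i then 1 + (\<Sum>r\<in>I - {i}. G i r * Y r) else G i j * Y i"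
    and "B \<equiv> \<lambda>i j. if j = i then (\<Sum>r\<in>I - {i}. G i r * X r) else G i j * X i"
    and "D \<equiv> \<lambda>i j. if j = i then - 2 * (\<Sum>r\<in>I - {i}. G i r * Z r) else - 2 * G i j * Z i"
  shows "(\<Sum>r\<in>I. 4 * Z r * (B i r * A j r - A i r * B j r)
      + 2 * X r * (D i r * A j r - A i r * D j r) + 2 * Y r * (B i r * D j r - D i r * B j r)) = 0"
    (is "(\<Sum>r\<in>I. ?t r) = 0")
proof -
  define R where "R = I - {i, j}"
  have finR: "finite R" using I by (simp add: R_def)
  have IR: "I = insert i (insert j R)" "i \<notin> R" "j \<notin> R" using I by (auto simp: R_def)
  have Ii: "I - {i} = insert j R" and Ij: "I - {j} = insert i R" using I by (auto simp: R_def)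
  define g where "g = G i j"
  have g': "G j i = - g"
    by (simp add: g_def G_def minus_divide_right del: minus_divide_right[symmetric])
  define S where "S = (\<lambda>p f. \<Sum>r\<in>R. G p r * f r)"
  have Si: "(\<Sum>r\<in>I - {i}. G i r * f r) = g * f j + S i f" for f
    using finR IR(2,3) by (simp add: Ii g_def S_def)
  have Sj: "(\<Sum>r\<in>I - {j}. G j r * f r) = - g * f i + S j f" for f
    using finR IR(2,3) by (simp add: Ij g' S_def)
  \<comment> \<open>Partial fractions: the classical Yang-Baxter identity for
    \<open>1 / (a p - a q)\<close>.\<close>
  have prod: "G i r * G j r = g * (G j r - G i r)" if "r \<in> R" for r
  proof -
    have "a i - a r \<noteq> 0" "a j - a r \<noteq> 0" "a i - a j \<noteq> 0"
      using that I a by (auto simp: R_def inj_on_def)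
    then show ?thesis by (simp add: G_def g_def divide_simps)
  qed
  have "(\<Sum>r\<in>R. ?t r) = (\<Sum>r\<in>R. 4 * g * ((G j r * Z r - G i r * Z r) * (X i * Y j - Y i * X j)
      + (G j r * X r - G i r * X r) * (Y i * Z j - Z i * Y j)
      + (G j r * Y r - G i r * Y r) * (Z i * X j - X i * Z j)))"
  proof (intro sum.cong refl)
    fix r assume r: "r \<in> R"
    then have "r \<noteq> i" "r \<noteq> j" using IR by auto
    then have "?t r = 4 * (G i r * G j r) * (Z r * (X i * Y j - Y i * X j)
      + X r * (Y i * Z j - Z i * Y j) + Y r * (Z i * X j - X i * Z j))"
      by (simp add: A_def B_def D_def algebra_simps)
    then show "?t r = 4 * g * ((G j r * Z r - G i r * Z r) * (X i * Y j - Y i * X j)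
      + (G j r * X r - G i r * X r) * (Y i * Z j - Z i * Y j)
      + (G j r * Y r - G i r * Y r) * (Z i * X j - X i * Z j))"
      unfolding prod[OF r] by (simp add: algebra_simps)
  qed
  also have "\<dots> = 4 * g * ((S j Z - S i Z) * (X i * Y j - Y i * X j)
      + (S j X - S i X) * (Y i * Z j - Z i * Y j) + (S j Y - S i Y) * (Z i * X j - X i * Z j))"
    by (simp add: S_def sum.distrib sum_subtractf flip: sum_distrib_left sum_distrib_right)
  finally have "(\<Sum>r\<in>R. ?t r) = \<dots>" .
  moreover have "(\<Sum>r\<in>I. ?t r) = ?t i + ?t j + (\<Sum>r\<in>R. ?t r)"
    by (subst IR(1)) (use finR IR I(4) in simp)
  moreover have "A i i = 1 + (g * Y j + S i Y)" "B i i = g * X j + S i X"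
    "D i i = - 2 * (g * Z j + S i Z)" "A i j = g * Y i" "B i j = g * X i" "D i j = - 2 * g * Z i"
    "A j j = 1 + (- g * Y i + S j Y)" "B j j = - g * X i + S j X"
    "D j j = - 2 * (- g * Z i + S j Z)" "A j i = - g * Y j" "B j i = - g * X j" "D j i = 2 * g * Z j"
    using I(4) by (simp_all add: A_def B_def D_def Si Sj g' g_def[symmetric])
  ultimately show ?thesis
    by (simp only:) (simp add: algebra_simps)
qed

locale magnetic_sphere_distinct = magnetic_sphere e s k l m
  for e :: "nat \<Rightarrow> 'n::finite" and s :: real and k :: "nat \<Rightarrow> real" and l m :: nat +
  assumes apar_inj: "inj_on (apar e s k) {1..l}"
begin

declare One_nat_def [simp del]

abbreviation a :: "nat \<Rightarrow> real" where "a \<equiv> apar e s k"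
definition G :: "nat \<Rightarrow> nat \<Rightarrow> real" where "G p q = 1 / (4 * (a p - a q))"

section \<open>Partial derivatives of the integrals and of the energy\<close>

lemma F_integral_eq_G:
  assumes "i \<in> {1..l}"
  shows "F_integral e s k i x = (\<Sum>j\<in>{1..l} - {i}.
      G i j * (X x i * Y x j + X x j * Y x i - 2 * (Z x i * Z x j) + 2 * (Q x i * Q x j))) + X x i"
proof -
  have "(u / 4 + v / 2) / d = 1 / (4 * d) * (u + 2 * v)" for u v d :: real
    by (cases "d = 0") (simp_all add: field_simps)
  then show ?thesis
    unfolding F_integral_eq[OF assms] G_def by (simp only: mult.assoc)
qed

text \<open>The four families are the partial derivatives of \<open>F_integral e s k i\<close> in
  \<open>X x j\<close>, \<open>Y x j\<close>, \<open>Z x j\<close>, \<open>Q x j\<close>; block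
  \<open>i\<close> occurs in every summand, hence the separate diagonal case.\<close>

definition cX where
  "cX x i j = (if j = i then 1 + (\<Sum>r\<in>{1..l} - {i}. G i r * Y x r) else G i j * Y x i)"
definition cY where
  "cY x i j = (if j = i then (\<Sum>r\<in>{1..l} - {i}. G i r * X x r) else G i j * X x i)"
definition cZ where
  "cZ x i j = (if j = i then - 2 * (\<Sum>r\<in>{1..l} - {i}. G i r * Z x r) else - 2 * G i j * Z x i)"
definition cQ where
  "cQ x i j = (if j = i then 2 * (\<Sum>r\<in>{1..l} - {i}. G i r * Q x r) else 2 * G i j * Q x i)"

lemma has_block_derivative_F:
  assumes i: "i \<in> {1..l}"
  shows "has_block_derivative (F_integral e s k i) x (cX x i) (cY x i) (cZ x i) (cQ x i)"
proof (rule has_block_derivativeI)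
  note [derivative_intros] = has_derivative_block_quantities
  let ?D = "\<lambda>h. (\<Sum>j\<in>{1..l} - {i}. G i j * ((X x i * DY x j h + DX x i h * Y x j)
      + (X x j * DY x i h + DX x j h * Y x i) - 2 * (Z x i * DZ x j h + DZ x i h * Z x j)
      + 2 * (Q x i * DQ x j h + DQ x i h * Q x j))) + DX x i h"
  have "F_integral e s k i = (\<lambda>x. (\<Sum>j\<in>{1..l} - {i}.
      G i j * (X x i * Y x j + X x j * Y x i - 2 * (Z x i * Z x j) + 2 * (Q x i * Q x j))) + X x i)"
    using i by (intro ext F_integral_eq_G)
  moreover have "(\<dots> has_derivative ?D) (at x)"
    by (intro derivative_intros)
  ultimately show "(F_integral e s k i has_derivative ?D) (at x)" by simp
  fix h
  have "(\<Sum>j=1..l. cX x i j * DX x j h + cY x i j * DY x j h + cZ x i j * DZ x j h + cQ x i j * DQ x j h)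
    = (cX x i i * DX x i h + cY x i i * DY x i h + cZ x i i * DZ x i h + cQ x i i * DQ x i h)
      + (\<Sum>j\<in>{1..l} - {i}. G i j * Y x i * DX x j h + G i j * X x i * DY x j h
          - 2 * G i j * Z x i * DZ x j h + 2 * G i j * Q x i * DQ x j h)"
    by (subst sum.remove[OF _ i]) (auto simp: cX_def cY_def cZ_def cQ_def intro!: sum.cong)
  also have "\<dots> = ?D h"
    by (simp add: cX_def cY_def cZ_def cQ_def sum.distrib sum_subtractf sum_distrib_left
        sum_distrib_right sum_negf algebra_simps)
  finally show "?D h = (\<Sum>j=1..l. cX x i j * DX x j h + cY x i j * DY x j h
    + cZ x i j * DZ x j h + cQ x i j * DQ x j h)" ..
qed

text \<open>The sum is the derivative of \<open>F_integral e s k i\<close> along the fibre direction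
  \<open>fst x\<close>. It vanishes because adding the same real multiple of \<open>z\<close> to
  \<open>w\<close> in all blocks changes no \<open>phi e s k i j\<close>.\<close>

lemma F_block_constraint:
  assumes i: "i \<in> {1..l}"
  shows "(\<Sum>j=1..l. 2 * cY x i j * Z x j + cZ x i j * X x j) = 0"
proof -
  have "(\<Sum>j=1..l. 2 * cY x i j * Z x j + cZ x i j * X x j) = (2 * cY x i i * Z x i + cZ x i i * X x i)
      + (\<Sum>j\<in>{1..l} - {i}. 2 * G i j * X x i * Z x j - 2 * G i j * Z x i * X x j)"
    by (subst sum.remove[OF _ i]) (auto simp: cY_def cZ_def intro!: sum.cong)
  also have "\<dots> = 0"
    by (simp add: cY_def cZ_def sum_subtractf sum_distrib_left sum_distrib_right sum_negf algebra_simps)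
  finally show ?thesis .
qed

lemma has_block_derivative_Phi:
  assumes i: "i \<in> {1..m}"
  shows "has_block_derivative (Phi e s k i) x (\<lambda>_. 0) (\<lambda>_. 0) (\<lambda>_. 0) (\<lambda>j. of_bool (j = i))"
proof (rule has_block_derivativeI)
  have "Phi e s k i = (\<lambda>x. Q x i)" using i by (intro ext Phi_eq_Q)
  then show "(Phi e s k i has_derivative DQ x i) (at x)"
    by (simp add: has_derivative_block_quantities)
  fix h
  have "(\<Sum>j=1..l. (0::real) * DX x j h + 0 * DY x j h + 0 * DZ x j h + of_bool (j = i) * DQ x j h)
     = (\<Sum>j=1..l. if j = i then DQ x j h else 0)"
    by (intro sum.cong) auto
  then show "DQ x i h = (\<Sum>j=1..l. 0 * DX x j h + 0 * DY x j h + 0 * DZ x j h + of_bool (j = i) * DQ x j h)"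
    using m_le_l[OF i] by simp
qed

lemma has_block_derivative_kinetic_energy:
  "has_block_derivative kinetic_energy x
     (\<lambda>j. 2 * a j) (\<lambda>_. 1/2) (\<lambda>_. 0) (\<lambda>j. - (s * kpar e k j / 2))"
proof (rule has_block_derivativeI)
  note [derivative_intros] = has_derivative_block_quantities
  let ?D = "\<lambda>h. \<Sum>j=1..l. 1/2 * DY x j h - s * kpar e k j / 2 * DQ x j h + 2 * a j * DX x j h"
  have "kinetic_energy = (\<lambda>x. \<Sum>j=1..l. 1/2 * Y x j - s * kpar e k j / 2 * Q x j + 2 * a j * X x j)"
    by (intro ext kinetic_energy_eq)
  moreover have "(\<dots> has_derivative ?D) (at x)"
    by (intro derivative_intros)
  ultimately show "(kinetic_energy has_derivative ?D) (at x)" by simp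
  show "?D h = (\<Sum>j=1..l. 2 * a j * DX x j h + 1/2 * DY x j h + 0 * DZ x j h
    + - (s * kpar e k j / 2) * DQ x j h)" for h
    by (intro sum.cong) auto
qed

section \<open>Conservation and commutation on the phase space\<close>

lemma sum_X: "x \<in> cotangent_sphere \<Longrightarrow> (\<Sum>j=1..l. X x j) = 1"
  unfolding X_def inner_zc[symmetric] by (auto simp: cotangent_sphere_def)

lemma sum_Z:
  assumes "x \<in> cotangent_sphere"
  shows "(\<Sum>j=1..l. Z x j) = 0"
proof -
  have "fst x \<bullet> (K *v fst x) = 0"
    using kappa_skew_inner[of "fst x" "fst x"] by (simp add: inner_commute)
  moreover have "fst x \<bullet> snd x = 0"
    using assms by (auto simp: cotangent_sphere_def inner_commute)
  ultimately show ?thesis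
    unfolding Z_def inner_zc[symmetric] by (simp add: mom_def inner_diff_right)
qed

text \<open>The factors \<open>a i - a j\<close> produced by the energy cancel the denominators in
  \<open>G\<close>, which leaves sums of \<open>X\<close> and \<open>Z\<close> over the other
  blocks. The constraints \<open>sum_X\<close> and \<open>sum_Z\<close> make the remainder
  zero.\<close>

lemma bracket_sum_F_kinetic:
  assumes x: "x \<in> cotangent_sphere" and i: "i \<in> {1..l}"
  shows "bracket_sum x (cX x i) (cY x i) (cZ x i) (\<lambda>j. 2 * a j) (\<lambda>_. 1/2) (\<lambda>_. 0) = 0"
proof -
  have G: "G i j * (a i - a j) = 1/4" if "j \<in> {1..l} - {i}" for j
  proof -
    have "a i \<noteq> a j" using that i inj_onD[OF apar_inj, of i j] by blast
    then show ?thesis by (simp add: G_def)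
  qed
  let ?R = "{1..l} - {i}"
  have "bracket_sum x (cX x i) (cY x i) (cZ x i) (\<lambda>j. 2 * a j) (\<lambda>_. 1/2) (\<lambda>_. 0) =
    (\<Sum>j=1..l. 8 * a j * cY x i j * Z x j - 2 * cX x i j * Z x j
        + 4 * a j * cZ x i j * X x j - cZ x i j * Y x j)"
    by (simp add: bracket_sum_def algebra_simps)
  also have "\<dots> = (8 * a i * cY x i i * Z x i - 2 * cX x i i * Z x i
        + 4 * a i * cZ x i i * X x i - cZ x i i * Y x i)
     + (\<Sum>j\<in>?R. 8 * a j * (G i j * X x i) * Z x j - 2 * (G i j * Y x i) * Z x j
        + 4 * a j * (- 2 * G i j * Z x i) * X x j - (- 2 * G i j * Z x i) * Y x j)"
    by (subst sum.remove[OF _ i]) (auto simp: cX_def cY_def cZ_def intro!: sum.cong)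
  also have "\<dots> = - 2 * Z x i + (\<Sum>j\<in>?R. 8 * (G i j * (a i - a j)) * (Z x i * X x j - X x i * Z x j))"
    by (simp add: cX_def cY_def cZ_def sum.distrib sum_subtractf sum_distrib_left
        sum_distrib_right algebra_simps sum_negf)
  also have "\<dots> = - 2 * Z x i + (\<Sum>j\<in>?R. 2 * (Z x i * X x j - X x i * Z x j))"
    by (simp add: G cong: sum.cong_simp)
  also have "\<dots> = - 2 * Z x i + 2 * (Z x i * (\<Sum>j\<in>?R. X x j) - X x i * (\<Sum>j\<in>?R. Z x j))"
    by (simp add: sum_subtractf sum_distrib_left right_diff_distrib)
  also have "\<dots> = 0"
    using sum_X[OF x] sum_Z[OF x] i by (simp add: sum_diff1 algebra_simps)
  finally show ?thesis .
qed

text \<open>The partial derivative in \<open>Q\<close> is left unrestricted because the brackets do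
  not see it; every \<open>Phi\<close> thus counts as the zero triple.\<close>

lemma integrals_block_derivative:
  assumes "f \<in> Phi e s k ` {1..m} \<union> F_integral e s k ` {1..l}"
  obtains \<alpha> \<beta> \<delta> \<epsilon> where "has_block_derivative f x \<alpha> \<beta> \<delta> \<epsilon>"
    "(\<alpha>, \<beta>, \<delta>) \<in> insert (\<lambda>_. 0, \<lambda>_. 0, \<lambda>_. 0) ((\<lambda>i. (cX x i, cY x i, cZ x i)) ` {1..l})"
  using assms has_block_derivative_F[of _ x] has_block_derivative_Phi[of _ x] by blast

lemma block_constraint:
  assumes "(\<alpha>, \<beta>, \<delta>) \<in> insert (\<lambda>_. 0, \<lambda>_. 0, \<lambda>_. 0) ((\<lambda>i. (cX x i, cY x i, cZ x i)) ` {1..l})"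
  shows "(\<Sum>j=1..l. 2 * \<beta> j * Z x j + \<delta> j * X x j) = 0"
  using assms F_block_constraint[of _ x] by auto

lemma bracket_sum_zero:
  "bracket_sum x (\<lambda>_. 0) (\<lambda>_. 0) (\<lambda>_. 0) \<alpha> \<beta> \<delta> = 0"
  "bracket_sum x \<alpha> \<beta> \<delta> (\<lambda>_. 0) (\<lambda>_. 0) (\<lambda>_. 0) = 0"
  by (simp_all add: bracket_sum_def)

lemma bracket_sum_F:
  assumes "i \<in> {1..l}" "j \<in> {1..l}"
  shows "bracket_sum x (cX x i) (cY x i) (cZ x i) (cX x j) (cY x j) (cZ x j) = 0"
proof (cases "i = j")
  case True
  then show ?thesis by (simp add: bracket_sum_def)
next
  case False
  show ?thesis
    unfolding bracket_sum_def cX_def cY_def cZ_def G_def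
    using gaudin_bracket_zero[OF finite_atLeastAtMost assms False apar_inj] by this
qed

lemma integrals_commute:
  assumes x: "x \<in> cotangent_sphere"
    and "f \<in> Phi e s k ` {1..m} \<union> F_integral e s k ` {1..l}"
    and "g \<in> Phi e s k ` {1..m} \<union> F_integral e s k ` {1..l}"
  shows "poisson_bracket e s K f g x = 0"
proof -
  obtain \<alpha> \<beta> \<delta> \<epsilon> where f: "has_block_derivative f x \<alpha> \<beta> \<delta> \<epsilon>"
    "(\<alpha>, \<beta>, \<delta>) \<in> insert (\<lambda>_. 0, \<lambda>_. 0, \<lambda>_. 0) ((\<lambda>i. (cX x i, cY x i, cZ x i)) ` {1..l})"
    using integrals_block_derivative[OF assms(2)] .
  obtain \<alpha>' \<beta>' \<delta>' \<epsilon>' where g: "has_block_derivative g x \<alpha>' \<beta>' \<delta>' \<epsilon>'"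
    "(\<alpha>', \<beta>', \<delta>') \<in> insert (\<lambda>_. 0, \<lambda>_. 0, \<lambda>_. 0) ((\<lambda>i. (cX x i, cY x i, cZ x i)) ` {1..l})"
    using integrals_block_derivative[OF assms(3)] .
  have "bracket_sum x \<alpha> \<beta> \<delta> \<alpha>' \<beta>' \<delta>' = 0"
    using f(2) g(2) unfolding insert_iff image_iff prod.inject Bex_def
    by (elim disjE exE conjE) (simp_all only: bracket_sum_zero bracket_sum_F)
  then show ?thesis
    using poisson_bracket_block[OF x f(1) block_constraint[OF f(2)] g(1) block_constraint[OF g(2)]]
    by simp
qed

lemma integrals_differentiable:
  assumes "f \<in> Phi e s k ` {1..m} \<union> F_integral e s k ` {1..l}"
  shows "f differentiable (at x)"
proof -
  obtain \<alpha> \<beta> \<delta> \<epsilon> where "has_block_derivative f x \<alpha> \<beta> \<delta> \<epsilon>"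
    using integrals_block_derivative[OF assms] .
  then show ?thesis
    unfolding has_block_derivative_def by (rule differentiableI)
qed

lemma integrals_first_integral:
  assumes "f \<in> Phi e s k ` {1..m} \<union> F_integral e s k ` {1..l}"
  shows "first_integral (hamiltonian_vf e s K kinetic_energy) f"
proof (rule first_integralI[OF integrals_differentiable[OF assms]])
  fix x :: "'n phase" assume x: "x \<in> cotangent_sphere"
  obtain \<alpha> \<beta> \<delta> \<epsilon> where f: "has_block_derivative f x \<alpha> \<beta> \<delta> \<epsilon>"
    "(\<alpha>, \<beta>, \<delta>) \<in> insert (\<lambda>_. 0, \<lambda>_. 0, \<lambda>_. 0) ((\<lambda>i. (cX x i, cY x i, cZ x i)) ` {1..l})"
    using integrals_block_derivative[OF assms] .
  have "bracket_sum x \<alpha> \<beta> \<delta> (\<lambda>j. 2 * a j) (\<lambda>_. 1/2) (\<lambda>_. 0) = 0"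
    using f(2) unfolding insert_iff image_iff prod.inject Bex_def
    by (elim disjE exE conjE) (simp_all only: bracket_sum_zero bracket_sum_F_kinetic[OF x])
  \<comment> \<open>For the energy the orthogonality condition is \<open>sum_Z\<close>, as its
    derivative in every \<open>Y\<close> is \<open>1/2\<close>.\<close>
  then show "frechet_derivative f (at x) (hamiltonian_vf e s K kinetic_energy x) = 0"
    using frechet_derivative_hamiltonian_vf_block[OF x f(1) block_constraint[OF f(2)]
        has_block_derivative_kinetic_energy] sum_Z[OF x]
    by simp
qed


section \<open>Independence on a dense set\<close>

text \<open>A weighted graph Laplacian: the edge weight
  \<open>G r j * (X x j * Z x r - Z x j * X x r)\<close> is symmetric because both factors change
  sign when \<open>r\<close> and \<open>j\<close> are swapped. It arises as half the derivative
  along \<open>vert x r\<close> of the combination of the quadratic integrals with coefficients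
  \<open>d\<close>.\<close>

definition W :: "'n phase \<Rightarrow> (nat \<Rightarrow> real) \<Rightarrow> nat \<Rightarrow> real" where
  "W x d r = (\<Sum>j\<in>{1..l} - {r}. G r j * (d r - d j) * (X x j * Z x r - Z x j * X x r))"

lemma l_pos: "1 \<le> l"
  unfolding l using zero_less_card_finite[where 'a='n] by linarith

lemma G_anti: "G j i = - G i j"
  using minus_divide_right[of 1 "4 * (a i - a j)"] by (simp add: G_def)

lemma vertical_tangent: "v \<bullet> fst x = 0 \<Longrightarrow> (0, v) \<in> tangent_at x"
  by (simp add: tangent_at_def)

lemma mom_vertical: "mom (0, v) = v"
  by (simp add: mom_def)

text \<open>The fibre direction that rescales block \<open>r\<close>, corrected by a multiple of
  \<open>fst x\<close> to become tangent.\<close>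

definition vert :: "'n phase \<Rightarrow> nat \<Rightarrow> real^'n" where
  "vert x r = assemble (\<lambda>j. (of_bool (j = r) - X x r) *\<^sub>R zx x j)"

lemma zc_assemble_zx: "j \<in> {1..l} \<Longrightarrow> zc (assemble (\<lambda>j. q j *\<^sub>R zx x j)) j = q j *\<^sub>R zx x j"
  by (simp add: zc_assemble complex_eq_iff zc_real del: atLeastAtMost_iff)

lemma vert_orthogonal:
  assumes "x \<in> cotangent_sphere" "r \<in> {1..l}"
  shows "vert x r \<bullet> fst x = 0"
proof -
  have "vert x r \<bullet> fst x = (\<Sum>j=1..l. (if j = r then X x j else 0) - X x r * X x j)"
    unfolding vert_def assemble_inner
    by (intro sum.cong) (auto simp: X_def left_diff_distrib)
  also have "\<dots> = 0"
    using assms by (simp add: sum_subtractf sum_X flip: sum_distrib_left)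
  finally show ?thesis .
qed

text \<open>The multiple of \<open>fst x\<close> in \<open>vert\<close> drops out by
  \<open>F_block_constraint\<close>.\<close>

lemma frechet_derivative_F_vert:
  assumes i: "i \<in> {1..l}" and r: "r \<in> {1..l}"
  shows "frechet_derivative (F_integral e s k i) (at x) (0, vert x r)
    = 2 * cY x i r * Z x r + cZ x i r * X x r"
proof -
  have "frechet_derivative (F_integral e s k i) (at x) (0, vert x r) =
    (\<Sum>j=1..l. (if j = r then 2 * cY x i j * Z x j + cZ x i j * X x j else 0)
      - X x r * (2 * cY x i j * Z x j + cZ x i j * X x j))"
    unfolding frechet_derivative_block[OF has_block_derivative_F[OF i]]
  proof (intro sum.cong refl)
    fix j assume j: "j \<in> {1..l}"
    define q where "q = of_bool (j = r) - X x r"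
    have "zc (vert x r) j = q *\<^sub>R zx x j" unfolding vert_def q_def by (rule zc_assemble_zx[OF j])
    then have "cX x i j * DX x j (0, vert x r) + cY x i j * DY x j (0, vert x r)
      + cZ x i j * DZ x j (0, vert x r) + cQ x i j * DQ x j (0, vert x r)
      = q * (2 * cY x i j * Z x j + cZ x i j * X x j)"
      by (simp add: DX_def DY_def DZ_def DQ_def mom_vertical zc_zero
        Z_def X_def inner_complex_def algebra_simps)
    then show "cX x i j * DX x j (0, vert x r) + cY x i j * DY x j (0, vert x r)
      + cZ x i j * DZ x j (0, vert x r) + cQ x i j * DQ x j (0, vert x r)
      = (if j = r then 2 * cY x i j * Z x j + cZ x i j * X x j else 0)
        - X x r * (2 * cY x i j * Z x j + cZ x i j * X x j)"
      by (simp add: q_def left_diff_distrib)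
  qed
  also have "\<dots> = 2 * cY x i r * Z x r + cZ x i r * X x r"
    using r by (simp add: sum_subtractf F_block_constraint[OF i] flip: sum_distrib_left)
  finally show ?thesis .
qed

lemma frechet_derivative_Phi:
  assumes i: "i \<in> {1..m}"
  shows "frechet_derivative (Phi e s k i) (at x) h = DQ x i h"
proof -
  have "frechet_derivative (Phi e s k i) (at x) h = (\<Sum>j=1..l. if j = i then DQ x j h else 0)"
    unfolding frechet_derivative_block[OF has_block_derivative_Phi[OF i]]
    by (intro sum.cong) auto
  then show ?thesis using m_le_l[OF i] by simp
qed

lemma frechet_derivative_Phi_vert:
  assumes i: "i \<in> {1..m}"
  shows "frechet_derivative (Phi e s k i) (at x) (0, vert x r) = 0"
  unfolding frechet_derivative_Phi[OF i] DQ_def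
  by (simp add: mom_vertical zc_zero vert_def zc_assemble_zx[OF m_le_l[OF i]] inner_complex_def)

lemma sum_F_vert:
  assumes r: "r \<in> {1..l}"
  shows "(\<Sum>i=1..l. d i * (2 * cY x i r * Z x r + cZ x i r * X x r)) = 2 * W x d r"
proof -
  have "(\<Sum>i=1..l. d i * (2 * cY x i r * Z x r + cZ x i r * X x r)) =
     d r * (2 * cY x r r * Z x r + cZ x r r * X x r)
     + (\<Sum>i\<in>{1..l} - {r}. - 2 * G r i * d i * (X x i * Z x r - Z x i * X x r))"
    by (subst sum.remove[OF _ r])
      (auto simp: cY_def cZ_def G_anti[of _ r] algebra_simps intro!: sum.cong)
  also have "\<dots> = 2 * W x d r"
    by (simp add: W_def cY_def cZ_def sum_distrib_left sum_distrib_right sum.distrib sum_subtractf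
        sum_negf algebra_simps)
  finally show ?thesis .
qed

text \<open>Constants lie in the kernel of the Laplacian, reflecting that the quadratic integrals
  sum to 1 on the phase space; fixing \<open>d l = 0\<close> removes them.\<close>

definition nondegenerate :: "'n phase \<Rightarrow> bool" where
  "nondegenerate x \<longleftrightarrow>
     (\<forall>d. d l = 0 \<longrightarrow> (\<forall>r\<in>{1..<l}. W x d r = 0) \<longrightarrow> (\<forall>r\<in>{1..<l}. d r = 0))"

lemma integrals_independent:
  assumes x: "x \<in> cotangent_sphere" and X: "\<And>j. j \<in> {1..l} \<Longrightarrow> X x j \<noteq> 0"
    and nd: "nondegenerate x"
    and eq: "\<And>v. v \<in> tangent_at x \<Longrightarrow>
      (\<Sum>i=1..m. c i * frechet_derivative (Phi e s k i) (at x) v)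
      + (\<Sum>i\<in>{1..<l}. d i * frechet_derivative (F_integral e s k i) (at x) v) = 0"
  shows "(\<forall>i\<in>{1..m}. c i = 0) \<and> (\<forall>i\<in>{1..<l}. d i = 0)"
proof
  \<comment> \<open>The omitted integral number \<open>l\<close> gets coefficient zero, matching the
    normalisation in \<open>nondegenerate\<close>.\<close>
  define D where "D i = (if i < l then d i else 0)" for i
  have W: "W x D r = 0" if r: "r \<in> {1..l}" for r
  proof -
    have "0 = (\<Sum>i=1..m. c i * frechet_derivative (Phi e s k i) (at x) (0, vert x r))
      + (\<Sum>i\<in>{1..<l}. d i * frechet_derivative (F_integral e s k i) (at x) (0, vert x r))"
      by (rule eq[symmetric]) (intro vertical_tangent vert_orthogonal x r)
    also have "\<dots> = (\<Sum>i\<in>{1..<l}. d i * (2 * cY x i r * Z x r + cZ x i r * X x r))"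
      using r by (simp add: frechet_derivative_Phi_vert frechet_derivative_F_vert)
    also have "\<dots> = (\<Sum>i=1..l. D i * (2 * cY x i r * Z x r + cZ x i r * X x r))"
      by (rule sum.mono_neutral_cong_left) (auto simp: D_def)
    finally show ?thesis unfolding sum_F_vert[OF r] by simp
  qed
  then show d: "\<forall>i\<in>{1..<l}. d i = 0"
    using nd[unfolded nondegenerate_def, rule_format, of D] by (simp add: D_def)
  show "\<forall>i\<in>{1..m}. c i = 0"
  proof
    fix r assume r: "r \<in> {1..m}"
    \<comment> \<open>This direction rotates block \<open>r\<close> only, so among the linear
      integrals it is seen by number \<open>r\<close> alone, with derivative
      \<open>X x r\<close>.\<close>
    define v where "v = assemble (\<lambda>j. of_bool (j = r) *\<^sub>R (\<i> * zx x j))"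
    have v: "zc v j = of_bool (j = r) *\<^sub>R (\<i> * zx x j)" if "j \<in> {1..m}" for j
      using that m_le_l[OF that] by (simp add: v_def zc_assemble)
    have "v \<bullet> fst x = (\<Sum>j=1..l. 0)"
      unfolding v_def assemble_inner
      by (intro sum.cong refl) (simp add: inner_complex_def)
    then have "(0, v) \<in> tangent_at x" by (intro vertical_tangent) simp
    from eq[OF this] have "0 = (\<Sum>i=1..m. c i * frechet_derivative (Phi e s k i) (at x) (0, v))"
      using d by simp
    also have "\<dots> = (\<Sum>i=1..m. if i = r then c i * X x i else 0)"
      by (intro sum.cong refl)
        (auto simp: frechet_derivative_Phi DQ_def mom_vertical zc_zero v X_def inner_complex_def
          simp del: atLeastAtMost_iff)
    also have "\<dots> = c r * X x r" using r by simp
    finally show "c r = 0" using X m_le_l[OF r] by simp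
  qed
qed

section \<open>A determinant criterion for nondegeneracy\<close>

definition idx :: "'n \<Rightarrow> nat" where "idx = inv_into {1..CARD('n)} e"

lemma idx_e: "i \<in> {1..CARD('n)} \<Longrightarrow> idx (e i) = i"
  unfolding idx_def by (rule inv_into_f_f[OF bij_betw_imp_inj_on[OF e]])

lemma e_idx: "e (idx b) = b" and idx_range: "idx b \<in> {1..CARD('n)}"
proof -
  have b: "b \<in> e ` {1..CARD('n)}" using bij_betw_imp_surj_on[OF e] by simp
  show "e (idx b) = b" unfolding idx_def by (rule f_inv_into_f[OF b])
  show "idx b \<in> {1..CARD('n)}" unfolding idx_def by (rule inv_into_into[OF b])
qed

lemma less_l_range: "j \<in> {1..<l} \<Longrightarrow> j \<in> {1..CARD('n)}"
  unfolding l atLeastAtMost_iff atLeastLessThan_iff by linarith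

text \<open>
  Determinants are available for matrices indexed by a type only, so a family of \<open>l - 1\<close>
  functionals is completed by a multiple of the identity on the remaining coordinates.
\<close>

definition front :: "real^'n \<Rightarrow> nat \<Rightarrow> real" where
  "front d j = (if j \<in> {1..<l} then d $ e j else 0)"

definition padded :: "((nat \<Rightarrow> real) \<Rightarrow> nat \<Rightarrow> real) \<Rightarrow> real \<Rightarrow> real^'n \<Rightarrow> real^'n" where
  "padded w q d = (\<chi> b. if idx b < l then w (front d) (idx b) else q * d $ b)"

definition linear_family :: "((nat \<Rightarrow> real) \<Rightarrow> nat \<Rightarrow> real) \<Rightarrow> bool" where
  "linear_family w \<longleftrightarrow> (\<forall>f g r. w (\<lambda>j. f j + g j) r = w f r + w g r)
     \<and> (\<forall>c f r. w (\<lambda>j. c * f j) r = c * w f r)"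

lemma linear_padded:
  assumes "linear_family w"
  shows "linear (padded w q)"
proof (rule linearI)
  fix u v :: "real^'n" and c :: real
  have "front (u + v) = (\<lambda>j. front u j + front v j)" "front (c *\<^sub>R u) = (\<lambda>j. c * front u j)"
    by (simp_all add: front_def fun_eq_iff)
  then show "padded w q (u + v) = padded w q u + padded w q v"
    "padded w q (c *\<^sub>R u) = c *\<^sub>R padded w q u"
    using assms by (simp_all add: padded_def vec_eq_iff linear_family_def algebra_simps)
qed

lemma linear_family_W: "linear_family (W x)"
  unfolding linear_family_def W_def
  by (simp add: sum.distrib sum_distrib_left sum_subtractf algebra_simps)

lemma padded_eq_0_iff:
  "padded w q d = 0 \<longleftrightarrow> (\<forall>r\<in>{1..<l}. w (front d) r = 0) \<and> (\<forall>b. \<not> idx b < l \<longrightarrow> q * d $ b = 0)"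
proof -
  have "padded w q d = 0 \<longleftrightarrow>
    (\<forall>b. idx b < l \<longrightarrow> w (front d) (idx b) = 0) \<and> (\<forall>b. \<not> idx b < l \<longrightarrow> q * d $ b = 0)"
    by (auto simp: padded_def vec_eq_iff)
  moreover have "(\<forall>b. idx b < l \<longrightarrow> w (front d) (idx b) = 0) \<longleftrightarrow> (\<forall>r\<in>{1..<l}. w (front d) r = 0)"
  proof (intro iffI ballI allI impI)
    fix r assume *: "\<forall>b. idx b < l \<longrightarrow> w (front d) (idx b) = 0" and r: "r \<in> {1..<l}"
    then show "w (front d) r = 0" using *[rule_format, of "e r"] idx_e[OF less_l_range[OF r]] by simp
  next
    fix b assume "\<forall>r\<in>{1..<l}. w (front d) r = 0" "idx b < l"
    then show "w (front d) (idx b) = 0" using idx_range[of b] by simp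
  qed
  ultimately show ?thesis by simp
qed

lemma front_eq_0D:
  assumes "\<And>r. r \<in> {1..<l} \<Longrightarrow> front d r = 0" "\<And>b. \<not> idx b < l \<Longrightarrow> d $ b = 0"
  shows "d = 0"
proof -
  have "d $ b = 0" for b
  proof (cases "idx b < l")
    case True
    then have "idx b \<in> {1..<l}" using idx_range[of b] by simp
    then show ?thesis using assms(1)[of "idx b"] by (simp add: front_def e_idx)
  qed (rule assms(2))
  then show ?thesis by (simp add: vec_eq_iff)
qed

definition laplace_det :: "'n phase \<Rightarrow> real" where
  "laplace_det x = det (matrix (padded (W x) 1))"

lemma nondegenerate_if_det:
  assumes "laplace_det x \<noteq> 0"
  shows "nondegenerate x"
  unfolding nondegenerate_def
proof (intro allI impI ballI)
  fix d r assume d: "d l = (0::real)" "\<forall>r\<in>{1..<l}. W x d r = 0" and r: "r \<in> {1..<l}"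
  \<comment> \<open>\<open>v\<close> carries \<open>d\<close> on the first \<open>l - 1\<close>
    coordinates; its \<open>front\<close> agrees with \<open>d\<close> at \<open>l\<close> too
    because \<open>d l = 0\<close>.\<close>
  define v :: "real^'n" where "v = (\<chi> b. if idx b < l then d (idx b) else 0)"
  have front: "front v j = d j" if "j \<in> {1..l}" for j
  proof (cases "j = l")
    case False
    then have j: "j \<in> {1..<l}" using that by simp
    then have "front v j = (if idx (e j) < l then d (idx (e j)) else 0)" by (simp add: front_def v_def)
    then show ?thesis using idx_e[OF less_l_range[OF j]] j by simp
  qed (simp add: front_def d)
  have "W x (front v) r = W x d r" if "r \<in> {1..<l}" for r
    unfolding W_def using that by (intro sum.cong) (auto simp: front)
  then have "padded (W x) 1 v = 0"
    using d(2) by (auto simp: padded_eq_0_iff v_def)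
  then have "v = 0"
    using assms det_matrix_nz_iff[OF linear_padded[OF linear_family_W]] unfolding laplace_det_def by blast
  then have "front v r = 0" by (simp add: front_def)
  then show "d r = 0" using front[of r] r by simp
qed

lemma continuous_X: "continuous_on UNIV (\<lambda>x. X x j)" and continuous_Z: "continuous_on UNIV (\<lambda>x. Z x j)"
  using has_derivative_block_quantities[THEN has_derivative_continuous]
  by (auto simp: continuous_on_eq_continuous_at)

lemma continuous_laplace_det: "continuous_on UNIV laplace_det"
proof -
  have "continuous_on UNIV (\<lambda>x. matrix (padded (W x) 1) $ i $ j)" for i j
    by (cases "idx i < l")
      (simp_all add: matrix_def padded_def W_def continuous_intros continuous_X continuous_Z)
  then show ?thesis
    unfolding laplace_det_def[abs_def] det_def
    by (intro continuous_on_sum continuous_on_mult continuous_on_const continuous_on_prod)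
qed

definition generic_points :: "'n phase set" where
  "generic_points = {x \<in> cotangent_sphere. (\<Prod>j=1..l. X x j) * laplace_det x \<noteq> 0}"

lemma generic_points_iff:
  "x \<in> generic_points \<longleftrightarrow> x \<in> cotangent_sphere \<and> (\<forall>j\<in>{1..l}. X x j \<noteq> 0) \<and> laplace_det x \<noteq> 0"
  by (auto simp: generic_points_def)

lemma openin_generic_points: "openin (top_of_set cotangent_sphere) generic_points"
proof -
  have "open {x. (\<Prod>j=1..l. X x j) * laplace_det x \<noteq> 0}"
    by (intro open_Collect_neq continuous_intros continuous_X continuous_laplace_det)
  moreover have "generic_points = cotangent_sphere \<inter> {x. (\<Prod>j=1..l. X x j) * laplace_det x \<noteq> 0}"
    by (auto simp: generic_points_def)
  ultimately show ?thesis by (auto simp: openin_open)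
qed

section \<open>Density of the generic points\<close>

definition base_points :: "'n phase set" where
  "base_points = {x \<in> cotangent_sphere. \<forall>j\<in>{1..l}. X x j \<noteq> 0}"

text \<open>Shifting the position along the all-ones vector makes each coordinate vanish for one
  parameter value only, so all sufficiently small nonzero shifts leave every block nonzero.
  Normalising the position and projecting the momentum returns to the phase space.\<close>

lemma base_points_dense: "cotangent_sphere \<subseteq> closure base_points"
proof
  fix x :: "'n phase" assume x: "x \<in> cotangent_sphere"
  obtain \<gamma> p where xeq: "x = (\<gamma>, p)" by (cases x)
  have gg: "\<gamma> \<bullet> \<gamma> = 1" and pg: "p \<bullet> \<gamma> = 0" using x by (auto simp: xeq cotangent_sphere_def)
  define u where "u t = \<gamma> + t *\<^sub>R (\<chi> b. 1)" for t :: real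
  define g where "g t = u t /\<^sub>R norm (u t)" for t
  define c where "c t = (g t, p - (p \<bullet> g t) *\<^sub>R g t)" for t
  have "norm \<gamma> = 1" using gg by (simp add: norm_eq_sqrt_inner)
  then have g0: "g 0 = \<gamma>" by (simp add: g_def u_def)
  then have c0: "c 0 = x" by (simp add: c_def pg xeq)
  have "isCont g 0"
    unfolding g_def u_def using \<open>norm \<gamma> = 1\<close> by (intro continuous_intros) auto
  then have "isCont c 0" unfolding c_def by (intro continuous_intros)
  moreover have "\<forall>\<^sub>F t in at 0. t \<notin> (\<lambda>b. - \<gamma> $ b) ` UNIV"
    by (rule eventually_at_notin_finite) simp
  then have "\<forall>\<^sub>F t in at 0. c t \<in> base_points"
  proof (rule eventually_mono)
    fix t assume t: "t \<notin> (\<lambda>b. - \<gamma> $ b) ` UNIV"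
    have ut: "u t $ b \<noteq> 0" for b
    proof -
      have "t \<noteq> - \<gamma> $ b" using t by blast
      then show ?thesis by (simp add: u_def)
    qed
    then have "u t \<noteq> 0" by (metis zero_index)
    then have nz: "norm (u t) \<noteq> 0" by simp
    then have "norm (g t) = 1" by (simp add: g_def)
    then have g: "g t \<bullet> g t = 1" by (simp add: dot_square_norm)
    have "c t \<in> cotangent_sphere"
      using g by (simp add: c_def cotangent_sphere_def inner_diff_left)
    moreover have "X (c t) j \<noteq> 0" if j: "j \<in> {1..l}" for j
    proof -
      have "Re (zx (c t) j) \<noteq> 0"
        using ut nz by (simp add: c_def zcoord_components[OF j] g_def)
      then show ?thesis by (auto simp: X_def)
    qed
    ultimately show "c t \<in> base_points" by (simp add: base_points_def)
  qed
  ultimately show "x \<in> closure base_points" using in_closureI_path c0 by metis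
qed

text \<open>
  Moving the momentum by \<open>t\<close> times the vector field with blocks \<open>(a\<^sub>j - c) z\<^sub>j\<close> adds
  \<open>t/4\<close> times the Laplacian of the complete graph with weights \<open>X\<^sub>i X\<^sub>j\<close>, which is
  nondegenerate; the bad values of \<open>t\<close> are therefore zeros of a nonzero polynomial in \<open>1/t\<close>.
\<close>

lemma base_points_subset: "base_points \<subseteq> closure generic_points"
proof
  fix x assume "x \<in> base_points"
  then have x: "x \<in> cotangent_sphere" and X: "\<And>j. j \<in> {1..l} \<Longrightarrow> X x j \<noteq> 0"
    by (auto simp: base_points_def)
  \<comment> \<open>Subtracting the weighted mean makes \<open>v\<close> orthogonal to
    \<open>fst x\<close>; the differences \<open>\<rho> r - \<rho> j = a r - a j\<close> cancel the
    denominators in \<open>G\<close>.\<close>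
  define \<rho> where "\<rho> j = a j - (\<Sum>i=1..l. a i * X x i)" for j
  define v where "v = assemble (\<lambda>j. \<rho> j *\<^sub>R zx x j)"
  define c where "c t = (fst x, snd x + t *\<^sub>R v)" for t
  \<comment> \<open>\<open>B\<close> is the coefficient of \<open>t\<close> in
    \<open>W (c t)\<close>; the Laplacian with weights \<open>X x r * X x j\<close> takes this short
    form because the \<open>X x j\<close> sum to 1.\<close>
  define B where "B d r = X x r * (d r - (\<Sum>j=1..l. X x j * d j)) / 4" for d r
  have "v \<bullet> fst x = (\<Sum>j=1..l. a j * X x j - (\<Sum>i=1..l. a i * X x i) * X x j)"
    unfolding v_def assemble_inner by (intro sum.cong) (auto simp: X_def \<rho>_def left_diff_distrib)
  then have "v \<bullet> fst x = 0"
    using sum_X[OF x] by (simp add: sum_subtractf flip: sum_distrib_left)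
  then have cS: "c t \<in> cotangent_sphere" for t
    using x by (auto simp: c_def cotangent_sphere_def inner_add_left)
  have Xc: "X (c t) j = X x j" for t j by (simp add: c_def X_def)
  have Zc: "Z (c t) j = Z x j + t * (\<rho> j * X x j)" if "j \<in> {1..l}" for t j
    using zc_assemble_zx[OF that]
    by (simp add: c_def Z_def mom_def zc_linear v_def inner_add_right inner_diff_right X_def)
  have Wc: "W (c t) d r = W x d r + t * B d r" if r: "r \<in> {1..<l}" for t d r
  proof -
    have "W (c t) d r = (\<Sum>j\<in>{1..l} - {r}. G r j * (d r - d j) * (X x j * Z x r - Z x j * X x r)
        + t * (X x r * (X x j * (d r - d j)) / 4))"
      unfolding W_def
    proof (intro sum.cong refl)
      fix j assume j: "j \<in> {1..l} - {r}"
      have "a r \<noteq> a j" using j r inj_onD[OF apar_inj, of r j] by auto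
      then have G: "G r j * (\<rho> r - \<rho> j) = 1/4" by (simp add: G_def \<rho>_def)
      have "G r j * (d r - d j) * (X (c t) j * Z (c t) r - Z (c t) j * X (c t) r)
        = G r j * (d r - d j) * (X x j * Z x r - Z x j * X x r)
        + t * (X x r * (X x j * (d r - d j)) * (G r j * (\<rho> r - \<rho> j)))"
        using j r by (simp add: Xc Zc algebra_simps)
      then show "G r j * (d r - d j) * (X (c t) j * Z (c t) r - Z (c t) j * X (c t) r)
        = G r j * (d r - d j) * (X x j * Z x r - Z x j * X x r)
        + t * (X x r * (X x j * (d r - d j)) / 4)"
        unfolding G by simp
    qed
    also have "\<dots> = W x d r + t * (X x r * (\<Sum>j\<in>{1..l} - {r}. X x j * (d r - d j)) / 4)"
      by (simp add: W_def sum.distrib sum_distrib_left sum_divide_distrib)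
    also have "(\<Sum>j\<in>{1..l} - {r}. X x j * (d r - d j)) = (\<Sum>j=1..l. X x j * (d r - d j))"
      by (rule sum.mono_neutral_left) (use r in auto)
    also have "\<dots> = d r - (\<Sum>j=1..l. X x j * d j)"
      using sum_X[OF x] by (simp add: right_diff_distrib sum_subtractf flip: sum_distrib_right)
    finally show ?thesis by (simp add: B_def)
  qed
  have linB: "linear_family B"
    unfolding linear_family_def B_def
    by (simp add: sum.distrib sum_distrib_left sum_subtractf algebra_simps add_divide_distrib diff_divide_distrib)
  have injB: "d = 0" if "padded B 1 d = 0" for d
  proof (rule front_eq_0D)
    from that have B0: "B (front d) r = 0" if "r \<in> {1..<l}" for r
      using that by (simp add: padded_eq_0_iff)
    \<comment> \<open>\<open>S\<close> is the weighted mean of the entries of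
      \<open>front d\<close>, whose entry at \<open>l\<close> is zero. In the kernel all other
      entries equal \<open>S\<close>, so \<open>S = S - X x l * S\<close> and
      \<open>S = 0\<close>.\<close>
    define S where "S = (\<Sum>j=1..l. X x j * front d j)"
    have fr: "front d r = S" if "r \<in> {1..<l}" for r
      using B0[OF that] X[of r] that by (simp add: B_def S_def)
    have "S = (\<Sum>j=1..l. X x j * S - (if j = l then X x j * S else 0))"
    proof (subst (1) S_def, intro sum.cong refl)
      fix j assume "j \<in> {1..l}"
      then show "X x j * front d j = X x j * S - (if j = l then X x j * S else 0)"
        using fr[of j] by (cases "j = l") (simp_all add: front_def)
    qed
    also have "\<dots> = S - X x l * S"
      using sum_X[OF x] l_pos by (simp add: sum_subtractf flip: sum_distrib_right)
    finally have "S = 0" using X[of l] l_pos by simp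
    then show "front d r = 0" if "r \<in> {1..<l}" for r using fr[OF that] by simp
    show "d $ b = 0" if "\<not> idx b < l" for b
      using \<open>padded B 1 d = 0\<close> that by (simp add: padded_eq_0_iff)
  qed
  \<comment> \<open>\<open>W x\<close> is padded by 0, so that adding its multiples keeps the
    identity on the remaining coordinates of \<open>padded B 1\<close>.\<close>
  define F where "F = {q. det (matrix (padded B 1) + q *\<^sub>R matrix (padded (W x) 0)) = 0}"
  have "finite F"
    unfolding F_def
    by (rule finite_det_affine_zeros) (use injB det_matrix_nz_iff[OF linear_padded[OF linB]] in blast)
  have "laplace_det (c t) \<noteq> 0" if t: "t \<notin> inverse ` F" "t \<noteq> 0" for t
  proof -
    have "inverse t \<notin> F" using t by (metis image_eqI inverse_inverse_eq)
    let ?f = "\<lambda>d. padded B 1 d + inverse t *\<^sub>R padded (W x) 0 d"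
    have lin: "linear ?f"
      by (intro linear_compose_add linear_compose_scale_right linear_padded linB linear_family_W)
    have "matrix ?f = matrix (padded B 1) + inverse t *\<^sub>R matrix (padded (W x) 0)"
      by (simp add: matrix_def vec_eq_iff)
    then have "det (matrix ?f) \<noteq> 0" using \<open>inverse t \<notin> F\<close> by (simp add: F_def)
    then have inj: "d = 0" if "?f d = 0" for d
      using det_matrix_nz_iff[OF lin] that by blast
    have "d = 0" if "padded (W (c t)) 1 d = 0" for d
    proof (rule inj)
      have "W x (front d) r + t * B (front d) r = 0" if "r \<in> {1..<l}" for r
        using \<open>padded (W (c t)) 1 d = 0\<close> that by (simp add: padded_eq_0_iff Wc)
      then have "B (front d) r + inverse t * W x (front d) r = 0" if "r \<in> {1..<l}" for r
        using that t(2) by (simp add: field_simps)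
      then have "padded (\<lambda>d r. B d r + inverse t * W x d r) 1 d = 0"
        using that by (simp add: padded_eq_0_iff)
      moreover have "?f d = padded (\<lambda>d r. B d r + inverse t * W x d r) 1 d"
        by (simp add: padded_def vec_eq_iff)
      ultimately show "?f d = 0" by simp
    qed
    then show ?thesis
      unfolding laplace_det_def det_matrix_nz_iff[OF linear_padded[OF linear_family_W]] by blast
  qed
  then have generic: "c t \<in> generic_points" if "t \<notin> insert 0 (inverse ` F)" for t
    using that cS X by (simp add: generic_points_iff Xc)
  have "\<forall>\<^sub>F t in at 0. c t \<in> generic_points"
    by (rule eventually_mono[OF eventually_at_notin_finite[of "insert 0 (inverse ` F)"] generic])
      (use \<open>finite F\<close> in simp_all)
  moreover have "isCont c 0" unfolding c_def by (intro continuous_intros)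
  moreover have "c 0 = x" by (simp add: c_def)
  ultimately show "x \<in> closure generic_points" using in_closureI_path by metis
qed

lemma generic_points_dense: "cotangent_sphere \<subseteq> closure generic_points"
  using base_points_dense closure_minimal[OF base_points_subset closed_closure] by (rule subset_trans)

lemma liouville_integrable:
  "liouville_integrable_by e s K kinetic_energy (Phi e s k ` {1..m} \<union> F_integral e s k ` {1..l})"
proof -
  define g where "g = case_sum (Phi e s k) (F_integral e s k)"
  \<comment> \<open>The quadratic integral number \<open>l\<close> is left out;
    \<open>m + (l - 1)\<close> functions remain, as many as the dimension of the sphere.\<close>
  define I where "I = {1..m} <+> {1..<l}"
  have finI: "finite I" by (simp add: I_def)
  have ind: "\<forall>i\<in>I. c i = 0"
    if x: "x \<in> generic_points" and c: "\<And>v. v \<in> tangent_at x \<Longrightarrow>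
      (\<Sum>i\<in>I. c i * frechet_derivative (g i) (at x) v) = 0" for x c
  proof -
    have "(\<forall>i\<in>{1..m}. (c \<circ> Inl) i = 0) \<and> (\<forall>i\<in>{1..<l}. (c \<circ> Inr) i = 0)"
    proof (rule integrals_independent)
      show "x \<in> cotangent_sphere" "nondegenerate x" "\<And>j. j \<in> {1..l} \<Longrightarrow> X x j \<noteq> 0"
        using x nondegenerate_if_det by (auto simp: generic_points_iff)
      fix v assume "v \<in> tangent_at x"
      from c[OF this]
      show "(\<Sum>i=1..m. (c \<circ> Inl) i * frechet_derivative (Phi e s k i) (at x) v)
        + (\<Sum>i\<in>{1..<l}. (c \<circ> Inr) i * frechet_derivative (F_integral e s k i) (at x) v) = 0"
        by (simp add: I_def g_def sum.Plus)
    qed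
    then show ?thesis by (auto simp: I_def)
  qed
  obtain b :: 'n where True by blast
  \<comment> \<open>Independence at a single generic point already shows that the chosen functions
    are distinct, so the count needs one such point.\<close>
  have "(axis b 1, 0) \<in> (cotangent_sphere :: 'n phase set)"
    by (simp add: cotangent_sphere_def inner_axis_axis)
  then have "generic_points \<noteq> {}"
    using generic_points_dense by auto
  then obtain x0 where x0: "x0 \<in> generic_points" by blast
  have "card (g ` I) = card I"
    using functionally_independent_image(1)[OF finI ind[OF x0]] by (rule card_image)
  also have "\<dots> = CARD('n) - 1"
    using l_pos unfolding I_def by (simp add: card_Plus m l)
  finally have card: "card (g ` I) = CARD('n) - 1" .
  have sub: "g ` I \<subseteq> Phi e s k ` {1..m} \<union> F_integral e s k ` {1..l}"
    by (auto simp: I_def g_def)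
  have "\<forall>x\<in>generic_points. functionally_independent_at x (g ` I)"
  proof
    fix x assume x: "x \<in> generic_points"
    show "functionally_independent_at x (g ` I)"
      by (rule functionally_independent_image(2)[OF finI ind[OF x]])
  qed
  then have "\<exists>S\<subseteq>Phi e s k ` {1..m} \<union> F_integral e s k ` {1..l}. card S = CARD('n) - 1 \<and>
      (\<exists>U. openin (top_of_set cotangent_sphere) U \<and> cotangent_sphere \<subseteq> closure U \<and>
        (\<forall>x\<in>U. functionally_independent_at x S))"
    using card sub openin_generic_points generic_points_dense by (intro exI conjI)
  then show ?thesis
    unfolding liouville_integrable_by_def
    by (intro conjI ballI integrals_differentiable integrals_first_integral integrals_commute)
qed

end

theorem theorem3:
  fixes e :: "nat \<Rightarrow> 'n::finite" and n m l :: nat and s :: real and k :: "nat \<Rightarrow> real"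
  assumes "n = CARD('n)" and "n \<ge> 2" and "bij_betw e {1..n} UNIV"
    and "m = n div 2" and "l = (n + 1) div 2"
    and "s \<noteq> 0"
    and "\<And>i. i \<in> {1..m} \<Longrightarrow> k i \<ge> 0"
    and "inj_on k {1..m}"
    and "odd n \<Longrightarrow> \<forall>i\<in>{1..m}. k i \<noteq> 0"
  shows "(\<forall>x\<in>cotangent_sphere.
            hamiltonian_vf e s (kappa e k) kinetic_energy x = magnetic_vf s (kappa e k) x) \<and>
         liouville_integrable_by e s (kappa e k) kinetic_energy
            (Phi e s k ` {1..m} \<union> F_integral e s k ` {1..l})"
proof -
  have m: "m = CARD('n) div 2" and l: "l = (CARD('n) + 1) div 2"
    and e: "bij_betw e {1..CARD('n)} UNIV"
    using assms(1,3,4,5) by simp_all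
  have "inj_on (apar e s k) {1..l}"
    unfolding l
  proof (rule apar_inj_on[OF assms(6)])
    show "k i \<ge> 0" if "i \<in> {1..CARD('n) div 2}" for i
      using assms(7) that by (simp add: m)
    show "inj_on k {1..CARD('n) div 2}" using assms(8) by (simp add: m)
    show "\<forall>i\<in>{1..CARD('n) div 2}. k i \<noteq> 0" if "odd CARD('n)"
      using assms(1,9) that by (simp add: m)
  qed
  then interpret magnetic_sphere_distinct e s k l m
    by unfold_locales (rule m l e | assumption)+
  show ?thesis using hamiltonian_vf_kinetic_energy liouville_integrable by blast
qed

end
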